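(* For every group $\Gamma\in\mathbf{NC}_1$ there exists a short exact sequence of groups $1\to F\to\Gamma\to\Gamma_0\to 1$, where $F$ is finite and $\Gamma_0$ has infinite conjugacy classes (icc). In particular, if $\Gamma$ is torsion free, then $\Gamma$ is icc and non-inner amenable.
   Context: All groups are countable and discrete. A group is icc if it is infinite and the conjugacy class of every non-identity element is infinite. A group $\Gamma$ is inner amenable if there is a finitely additive probability measure on $\Gamma\setminus\{e\}$ invariant under conjugation by $\Gamma$; non-inner amenable means this fails. Let $\pi:\Gamma\to\mathcal O(\mathcal H)$ be an orthogonal representation on a real Hilbert space. A map $q:\Gamma\to\mathcal H$ is a quasi-cocycle for $\pi$ if there is $C\ge 0$ with $\sup_{\gamma,\lambda\in\Gamma}\|q(\gamma\lambda)-q(\gamma)-\pi_\gamma(q(\lambda))\|\le C$. It is anti-symmetric if $q(\gamma)=-\pi_\gamma(q(\gamma^{-1}))$ for all $\gamma$. $\mathcal{QH}^1_{as}(\Gamma,\pi)$ is the set of all unbounded, anti-symmetric quasi-cocycles for $\pi$. $\pi$ is mixing if $\lim_{\gamma\to\infty}\langle\pi_\gamma(\xi),\eta\rangle=0$ for all $\xi,\eta\in\mathcal H$; it is weakly-$\ell^2$ if it is weakly contained in the left regular representation $\ell^2_{\mathbb R}(\Gamma)$. $\Gamma\in\mathbf{NC}_1$ if $\Gamma$ is non-amenable and there is a weakly-$\ell^2$, mixing, orthogonal representation $\pi$ of $\Gamma$ with $\mathcal{QH}^1_{as}(\Gamma,\pi)\ne\emptyset$. *)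

theory Defs
  imports "HOL-Analysis.Analysis" "HOL-Algebra.Exact_Sequence"
begin

section \<open>Group-theoretic notions\<close>

definition icc :: "('g, 'm) monoid_scheme \<Rightarrow> bool" where
  "icc G \<longleftrightarrow> infinite (carrier G) \<and>
     (\<forall>x \<in> carrier G - {\<one>\<^bsub>G\<^esub>}. infinite ((\<lambda>g. g \<otimes>\<^bsub>G\<^esub> x \<otimes>\<^bsub>G\<^esub> inv\<^bsub>G\<^esub> g) ` carrier G))"

definition torsion_free :: "('g, 'm) monoid_scheme \<Rightarrow> bool" where
  "torsion_free G \<longleftrightarrow>
     (\<forall>x \<in> carrier G - {\<one>\<^bsub>G\<^esub>}. \<forall>n::nat. n > 0 \<longrightarrow> x [^]\<^bsub>G\<^esub> n \<noteq> \<one>\<^bsub>G\<^esub>)"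

text \<open>Only the values of \<open>m\<close> on subsets of \<open>X\<close> matter.\<close>

definition fin_additive_prob :: "'a set \<Rightarrow> ('a set \<Rightarrow> real) \<Rightarrow> bool" where
  "fin_additive_prob X m \<longleftrightarrow>
     (\<forall>A \<subseteq> X. 0 \<le> m A) \<and> m X = 1 \<and> additive (Pow X) m"

definition amenable :: "('g, 'm) monoid_scheme \<Rightarrow> bool" where
  "amenable G \<longleftrightarrow>
     (\<exists>m. fin_additive_prob (carrier G) m \<and>
          (\<forall>g \<in> carrier G. \<forall>A \<subseteq> carrier G. m ((\<lambda>x. g \<otimes>\<^bsub>G\<^esub> x) ` A) = m A))"

definition inner_amenable :: "('g, 'm) monoid_scheme \<Rightarrow> bool" where
  "inner_amenable G \<longleftrightarrow>
     (\<exists>m. fin_additive_prob (carrier G - {\<one>\<^bsub>G\<^esub>}) m \<and>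
          (\<forall>g \<in> carrier G. \<forall>A \<subseteq> carrier G - {\<one>\<^bsub>G\<^esub>}.
             m ((\<lambda>x. g \<otimes>\<^bsub>G\<^esub> x \<otimes>\<^bsub>G\<^esub> inv\<^bsub>G\<^esub> g) ` A) = m A))"

section \<open>Orthogonal representations\<close>

text \<open>A real Hilbert space is a type of sort \<open>{real_inner, complete_space}\<close>.
  Representations and quasi-cocycles are total functions on the type \<open>'g\<close>; only
  their values on \<open>carrier G\<close> are constrained. Surjectivity is required because
  \<^const>\<open>orthogonal_transformation\<close> only says that a map is a linear isometry.\<close>

definition orthogonal_rep ::
    "('g, 'm) monoid_scheme \<Rightarrow> ('g \<Rightarrow> 'h \<Rightarrow> 'h::{real_inner,complete_space}) \<Rightarrow> bool" where
  "orthogonal_rep G \<pi> \<longleftrightarrow>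
     (\<forall>g \<in> carrier G. orthogonal_transformation (\<pi> g) \<and> surj (\<pi> g)) \<and>
     (\<forall>g \<in> carrier G. \<forall>h \<in> carrier G. \<pi> (g \<otimes>\<^bsub>G\<^esub> h) = \<pi> g \<circ> \<pi> h)"

definition mixing ::
    "('g, 'm) monoid_scheme \<Rightarrow> ('g \<Rightarrow> 'h \<Rightarrow> 'h::{real_inner,complete_space}) \<Rightarrow> bool" where
  "mixing G \<pi> \<longleftrightarrow>
     (\<forall>\<xi> \<eta>. filterlim (\<lambda>g. inner (\<pi> g \<xi>) \<eta>) (nhds 0)
              (inf cofinite (principal (carrier G))))"

text \<open>Weak containment of \<open>\<pi>\<close> (on the space \<open>H\<close> with inner product \<open>ip\<close>) in \<open>\<rho>\<close>
  (on \<open>K\<close> with inner product \<open>iq\<close>), for a discrete group with underlying set \<open>X\<close>: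
  every function of positive type associated to \<open>\<pi>\<close> is a limit, uniformly on finite
  sets, of finite sums of functions of positive type associated to \<open>\<rho>\<close>
  (Bekka--de la Harpe--Valette, Definition F.1.1, with real scalars).
  The spaces are explicit sets so that \<open>\<rho>\<close> can live on a space of functions.\<close>

definition weakly_contained ::
    "'g set \<Rightarrow> 'h set \<Rightarrow> ('h \<Rightarrow> 'h \<Rightarrow> real) \<Rightarrow> ('g \<Rightarrow> 'h \<Rightarrow> 'h) \<Rightarrow>
     'k set \<Rightarrow> ('k \<Rightarrow> 'k \<Rightarrow> real) \<Rightarrow> ('g \<Rightarrow> 'k \<Rightarrow> 'k) \<Rightarrow> bool" where
  "weakly_contained X H ip \<pi> K iq \<rho> \<longleftrightarrow>
     (\<forall>\<xi> \<in> H. \<forall>S \<epsilon>. finite S \<and> S \<subseteq> X \<and> \<epsilon> > 0 \<longrightarrow>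
        (\<exists>\<eta>s. set \<eta>s \<subseteq> K \<and>
           (\<forall>g \<in> S. \<bar>ip (\<pi> g \<xi>) \<xi> - (\<Sum>\<eta>\<leftarrow>\<eta>s. iq (\<rho> g \<eta>) \<eta>)\<bar> < \<epsilon>)))"

text \<open>The real Hilbert space of square-summable functions on \<open>carrier G\<close>; functions
  are extended by zero outside the carrier.\<close>

definition ell2 :: "('g, 'm) monoid_scheme \<Rightarrow> ('g \<Rightarrow> real) set" where
  "ell2 G = {f. (\<forall>x. x \<notin> carrier G \<longrightarrow> f x = 0) \<and> (\<lambda>x. (f x)\<^sup>2) summable_on carrier G}"

definition ell2_inner ::
    "('g, 'm) monoid_scheme \<Rightarrow> ('g \<Rightarrow> real) \<Rightarrow> ('g \<Rightarrow> real) \<Rightarrow> real" where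
  "ell2_inner G f h = (\<Sum>\<^sub>\<infinity>x\<in>carrier G. f x * h x)"

definition left_regular ::
    "('g, 'm) monoid_scheme \<Rightarrow> 'g \<Rightarrow> ('g \<Rightarrow> real) \<Rightarrow> 'g \<Rightarrow> real" where
  "left_regular G g f = (\<lambda>x. if x \<in> carrier G then f (inv\<^bsub>G\<^esub> g \<otimes>\<^bsub>G\<^esub> x) else 0)"

definition weakly_ell2 ::
    "('g, 'm) monoid_scheme \<Rightarrow> ('g \<Rightarrow> 'h \<Rightarrow> 'h::{real_inner,complete_space}) \<Rightarrow> bool" where
  "weakly_ell2 G \<pi> \<longleftrightarrow>
     weakly_contained (carrier G) UNIV inner \<pi> (ell2 G) (ell2_inner G) (left_regular G)"

section \<open>Quasi-cocycles\<close>

definition quasi_cocycle ::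
    "('g, 'm) monoid_scheme \<Rightarrow> ('g \<Rightarrow> 'h \<Rightarrow> 'h::{real_inner,complete_space}) \<Rightarrow>
     ('g \<Rightarrow> 'h) \<Rightarrow> bool" where
  "quasi_cocycle G \<pi> q \<longleftrightarrow>
     (\<exists>C \<ge> 0. \<forall>g \<in> carrier G. \<forall>h \<in> carrier G.
        norm (q (g \<otimes>\<^bsub>G\<^esub> h) - q g - \<pi> g (q h)) \<le> C)"

definition antisymmetric ::
    "('g, 'm) monoid_scheme \<Rightarrow> ('g \<Rightarrow> 'h \<Rightarrow> 'h::{real_inner,complete_space}) \<Rightarrow>
     ('g \<Rightarrow> 'h) \<Rightarrow> bool" where
  "antisymmetric G \<pi> q \<longleftrightarrow> (\<forall>g \<in> carrier G. q g = - \<pi> g (q (inv\<^bsub>G\<^esub> g)))"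

definition QH1_as ::
    "('g, 'm) monoid_scheme \<Rightarrow> ('g \<Rightarrow> 'h \<Rightarrow> 'h::{real_inner,complete_space}) \<Rightarrow>
     ('g \<Rightarrow> 'h) set" where
  "QH1_as G \<pi> =
     {q. quasi_cocycle G \<pi> q \<and> antisymmetric G \<pi> q \<and> \<not> bounded (q ` carrier G)}"

text \<open>Membership in the class \<open>NC\<^sub>1\<close>, witnessed on the Hilbert space \<open>'h\<close>. HOL
  cannot quantify existentially over types, so the Hilbert space is a type argument;
  in a hypothesis \<open>NC1 TYPE('h) G\<close> with \<open>'h\<close> a type variable, it ranges over all
  real Hilbert spaces, which is the same as assuming that some Hilbert space works.\<close>

definition NC1 ::
    "'h::{real_inner,complete_space} itself \<Rightarrow> ('g, 'm) monoid_scheme \<Rightarrow> bool" where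
  "NC1 (_ :: 'h itself) G \<longleftrightarrow> \<not> amenable G \<and>
     (\<exists>\<pi> :: 'g \<Rightarrow> 'h \<Rightarrow> 'h.
        orthogonal_rep G \<pi> \<and> weakly_ell2 G \<pi> \<and> mixing G \<pi> \<and> QH1_as G \<pi> \<noteq> {})"

end

theory Submission
  imports Defs
begin

text \<open>Let \<open>q\<close> be an unbounded anti-symmetric quasi-cocycle for \<open>\<pi>\<close>. Anti-symmetry gives, up to a
  bounded error, \<open>q (g x g\<inverse>) - \<pi>\<^sub>g (q x) = q g - \<pi>\<^sub>y (q g)\<close> with \<open>y = g x g\<inverse>\<close>.
  Suppose \<open>m\<close> is a conjugation invariant mean on \<open>\<Gamma>\<close> that vanishes on finite sets.

  If \<open>m {x. norm (q x) \<le> r} > 1/2\<close> for some \<open>r\<close>, then for every \<open>g\<close> there are infinitely many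
  \<open>x\<close> for which \<open>q x\<close> and \<open>q (g x g\<inverse>)\<close> are both bounded by \<open>r\<close>; by mixing,
  \<open>norm (q g - \<pi>\<^sub>y (q g))\<close> is then close to \<open>sqrt 2 * norm (q g)\<close>, so \<open>q\<close> is bounded, a contradiction.

  Otherwise \<open>q\<close> is large on a set \<open>Y\<close> of measure at least \<open>1/2\<close>, where \<open>\<xi> x = q x / norm (q x)\<close> is
  almost equivariant. Non-amenability and weak containment in the regular representation give
  a spectral gap for the conjugation action twisted by \<open>\<pi>\<close>. Testing it on \<open>\<xi>\<close> restricted to
  finite sets shows that a finite set of conjugations expands every finite subset of \<open>Y\<close> by
  the factor 3, so Hall's theorem packs three copies of \<open>Y\<close> into \<open>\<Gamma>\<close>, and \<open>3/2 \<le> 1\<close>.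

  An infinite FC-center carries such a mean, namely a limit of the uniform measures on finite
  conjugacy classes, and so does an inner amenable icc group. Hence the FC-center of \<open>\<Gamma>\<close> is
  finite, and the quotient by it is icc.\<close>

section \<open>Square-summable functions\<close>

text \<open>Values lie in an arbitrary real inner product space, so that one calculus serves both
  real functions in the regular representation and \<open>'h\<close>-valued functions in the twisted
  one.\<close>

definition sq_summable :: "'a set \<Rightarrow> ('a \<Rightarrow> 'h::real_inner) \<Rightarrow> bool" where
  "sq_summable X v \<longleftrightarrow> (\<lambda>x. (norm (v x))\<^sup>2) summable_on X"

text \<open>\<open>infsum\<close> is 0 on a non-summable family, which is why the additivity laws
  below carry \<open>sq_summable\<close> hypotheses.\<close>

definition l2ip :: "'a set \<Rightarrow> ('a \<Rightarrow> 'h::real_inner) \<Rightarrow> ('a \<Rightarrow> 'h) \<Rightarrow> real" where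
  "l2ip X v w = (\<Sum>\<^sub>\<infinity>x\<in>X. inner (v x) (w x))"

lemma abs_inner_le: "\<bar>inner (a::'h::real_inner) b\<bar> \<le> (norm a)\<^sup>2 + (norm b)\<^sup>2"
proof -
  have "\<bar>inner a b\<bar> \<le> norm a * norm b" by (rule Cauchy_Schwarz_ineq2)
  moreover have "0 \<le> (norm a - norm b)\<^sup>2" by simp
  moreover have "0 \<le> (norm a)\<^sup>2 + (norm b)\<^sup>2" by simp
  ultimately show ?thesis unfolding power2_diff by linarith
qed

lemma sq_summable_inner:
  fixes v w :: "'a \<Rightarrow> 'h::real_inner"
  assumes "sq_summable X v" "sq_summable X w"
  shows "(\<lambda>x. inner (v x) (w x)) summable_on X"
proof -
  have "(\<lambda>x. (norm (v x))\<^sup>2 + (norm (w x))\<^sup>2) summable_on X"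
    using assms summable_on_add unfolding sq_summable_def by blast
  then have "(\<lambda>x. \<bar>inner (v x) (w x)\<bar>) summable_on X"
    by (rule summable_on_comparison_test) (auto intro: abs_inner_le)
  then show ?thesis
    using summable_on_iff_abs_summable_on_real by (auto simp: real_norm_def)
qed

lemma sq_summable_add:
  fixes v w :: "'a \<Rightarrow> 'h::real_inner"
  assumes "sq_summable X v" "sq_summable X w"
  shows "sq_summable X (\<lambda>x. v x + w x)"
proof -
  have "(\<lambda>x. ((norm (v x))\<^sup>2 + (norm (w x))\<^sup>2) + 2 * inner (v x) (w x)) summable_on X"
    using assms sq_summable_inner[OF assms]
    by (intro summable_on_add summable_on_cmult_right) (auto simp: sq_summable_def)
  then show ?thesis
    unfolding sq_summable_def
    by (simp add: power2_norm_eq_inner inner_add_left inner_add_right inner_commute algebra_simps)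
qed

lemma sq_summable_scaleR:
  fixes v :: "'a \<Rightarrow> 'h::real_inner"
  assumes "sq_summable X v"
  shows "sq_summable X (\<lambda>x. c *\<^sub>R v x)"
  using assms unfolding sq_summable_def
  by (simp add: power_mult_distrib summable_on_cmult_right)

lemma sq_summable_diff:
  fixes v w :: "'a \<Rightarrow> 'h::real_inner"
  assumes "sq_summable X v" "sq_summable X w"
  shows "sq_summable X (\<lambda>x. v x - w x)"
  using sq_summable_add[OF assms(1) sq_summable_scaleR[OF assms(2), of "-1"]] by simp

lemma sq_summable_sum:
  fixes v :: "'i \<Rightarrow> 'a \<Rightarrow> 'h::real_inner"
  assumes "\<And>i. i \<in> I \<Longrightarrow> sq_summable X (v i)"
  shows "sq_summable X (\<lambda>x. \<Sum>i\<in>I. v i x)"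
  using assms
proof (induction I rule: infinite_finite_induct)
  case (insert i I)
  then show ?case by (simp add: sq_summable_add)
qed (auto simp: sq_summable_def)

lemma sq_summable_finite_support:
  fixes v :: "'a \<Rightarrow> 'h::real_inner"
  assumes "finite {x \<in> X. v x \<noteq> 0}"
  shows "sq_summable X v"
  unfolding sq_summable_def
  by (rule finite_nonzero_values_imp_summable_on) (use assms in simp)

lemma l2ip_commute: "l2ip X v w = l2ip X w v"
  by (simp add: l2ip_def inner_commute)

lemma l2ip_self_nonneg [simp]: "0 \<le> l2ip X v v"
  unfolding l2ip_def by (rule infsum_nonneg) simp

lemma l2ip_add_left:
  fixes v :: "'a \<Rightarrow> 'h::real_inner"
  assumes "sq_summable X v" "sq_summable X v'" "sq_summable X w"
  shows "l2ip X (\<lambda>x. v x + v' x) w = l2ip X v w + l2ip X v' w"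
  unfolding l2ip_def inner_add_left
  by (rule infsum_add) (use assms sq_summable_inner in auto)

lemma l2ip_scaleR_left: "l2ip X (\<lambda>x. c *\<^sub>R v x) w = c * l2ip X v w"
  unfolding l2ip_def inner_scaleR_left by (rule infsum_cmult_right')

lemma l2ip_diff_left:
  fixes v :: "'a \<Rightarrow> 'h::real_inner"
  assumes "sq_summable X v" "sq_summable X v'" "sq_summable X w"
  shows "l2ip X (\<lambda>x. v x - v' x) w = l2ip X v w - l2ip X v' w"
  using l2ip_add_left[OF assms(1) sq_summable_scaleR[OF assms(2), of "-1"] assms(3)]
    l2ip_scaleR_left[of X "-1" v' w] by simp

lemma l2ip_diff_right:
  fixes v :: "'a \<Rightarrow> 'h::real_inner"
  assumes "sq_summable X v" "sq_summable X v'" "sq_summable X w"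
  shows "l2ip X w (\<lambda>x. v x - v' x) = l2ip X w v - l2ip X w v'"
  using l2ip_diff_left[OF assms] unfolding l2ip_commute[of X w] .

lemma l2ip_scaleR_right: "l2ip X w (\<lambda>x. c *\<^sub>R v x) = c * l2ip X w v"
  using l2ip_scaleR_left[of X c v w] unfolding l2ip_commute[of X w] .

lemma l2ip_sum_left:
  fixes v :: "'i \<Rightarrow> 'a \<Rightarrow> 'h::real_inner"
  assumes "\<And>i. i \<in> I \<Longrightarrow> sq_summable X (v i)" "sq_summable X w"
  shows "l2ip X (\<lambda>x. \<Sum>i\<in>I. v i x) w = (\<Sum>i\<in>I. l2ip X (v i) w)"
  using assms
proof (induction I rule: infinite_finite_induct)
  case (insert i I)
  then show ?case
    by (simp add: l2ip_add_left sq_summable_sum)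
qed (auto simp: l2ip_def)

lemma l2ip_sum_right:
  fixes v :: "'i \<Rightarrow> 'a \<Rightarrow> 'h::real_inner"
  assumes "\<And>i. i \<in> I \<Longrightarrow> sq_summable X (v i)" "sq_summable X w"
  shows "l2ip X w (\<lambda>x. \<Sum>i\<in>I. v i x) = (\<Sum>i\<in>I. l2ip X w (v i))"
  using l2ip_sum_left[OF assms] unfolding l2ip_commute[of X w] .

lemma l2ip_cong:
  "(\<And>x. x \<in> X \<Longrightarrow> v x = v' x) \<Longrightarrow> (\<And>x. x \<in> X \<Longrightarrow> w x = w' x) \<Longrightarrow> l2ip X v w = l2ip X v' w'"
  unfolding l2ip_def by (rule infsum_cong) simp

lemma l2ip_finite_support:
  assumes "finite E" "E \<subseteq> X" "\<And>x. x \<in> X - E \<Longrightarrow> w x = 0"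
  shows "l2ip X v w = (\<Sum>x\<in>E. inner (v x) (w x))"
proof -
  have "l2ip X v w = (\<Sum>\<^sub>\<infinity>x\<in>E. inner (v x) (w x))"
    unfolding l2ip_def by (rule infsum_cong_neutral) (use assms in auto)
  then show ?thesis using assms(1) by simp
qed

lemma l2ip_diff_self:
  fixes v :: "'a \<Rightarrow> 'h::real_inner"
  assumes "sq_summable X v" "sq_summable X w"
  shows "l2ip X (\<lambda>x. v x - w x) (\<lambda>x. v x - w x) = l2ip X v v - 2 * l2ip X v w + l2ip X w w"
  using assms
  by (simp add: l2ip_diff_left l2ip_diff_right sq_summable_diff l2ip_commute[of X w v])

text \<open>The squared norm of \<open>s v - t w\<close> is a nonnegative quadratic form in
  \<open>s\<close> and \<open>t\<close>. Its coefficient \<open>?b\<close> may vanish, so that case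
  is separate.\<close>

lemma l2ip_Cauchy_Schwarz:
  fixes v :: "'a \<Rightarrow> 'h::real_inner"
  assumes v: "sq_summable X v" and w: "sq_summable X w"
  shows "(l2ip X v w)\<^sup>2 \<le> l2ip X v v * l2ip X w w"
proof -
  let ?a = "l2ip X v v" and ?b = "l2ip X w w" and ?c = "l2ip X v w"
  have q: "0 \<le> s\<^sup>2 * ?a - 2 * s * t * ?c + t\<^sup>2 * ?b" for s t
  proof -
    have "0 \<le> l2ip X (\<lambda>x. s *\<^sub>R v x - t *\<^sub>R w x) (\<lambda>x. s *\<^sub>R v x - t *\<^sub>R w x)" by simp
    also have "\<dots> = s\<^sup>2 * ?a - 2 * s * t * ?c + t\<^sup>2 * ?b"
      using v w
      by (simp add: l2ip_diff_self sq_summable_scaleR l2ip_scaleR_left l2ip_scaleR_right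
          power2_eq_square)
    finally show ?thesis .
  qed
  show ?thesis
  proof (cases "?b = 0")
    case True
    have "?c = 0"
    proof (rule ccontr)
      assume c: "?c \<noteq> 0"
      \<comment> \<open>With \<open>s = 1\<close> and the quadratic term gone, this \<open>t\<close>
        makes the form equal to -1.\<close>
      have "0 \<le> ?a - 2 * ((?a + 1) / (2 * ?c)) * ?c"
        using q[of 1 "(?a + 1) / (2 * ?c)"] True by simp
      also have "\<dots> = - 1" using c by (simp add: field_simps)
      finally show False by simp
    qed
    then show ?thesis using True by simp
  next
    case False
    then have b: "?b > 0" using l2ip_self_nonneg[of X w] by linarith
    \<comment> \<open>At \<open>s = ?b\<close> and \<open>t = ?c\<close> the form is
      \<open>?b\<close> times the desired difference.\<close>
    have "0 \<le> ?b * (?a * ?b - ?c\<^sup>2)"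
      using q[of ?b ?c] by (simp add: power2_eq_square algebra_simps)
    then show ?thesis using b by (simp add: zero_le_mult_iff)
  qed
qed

lemma l2ip_le_sqrt:
  fixes v :: "'a \<Rightarrow> 'h::real_inner"
  assumes "sq_summable X v" "sq_summable X w"
  shows "l2ip X v w \<le> sqrt (l2ip X v v) * sqrt (l2ip X w w)"
  using l2ip_Cauchy_Schwarz[OF assms] by (metis real_le_rsqrt real_sqrt_mult)

lemma l2ip_reindex:
  assumes "bij_betw f X X"
  shows "l2ip X (\<lambda>x. v (f x)) (\<lambda>x. w (f x)) = l2ip X v w"
  unfolding l2ip_def using infsum_reindex_bij_betw[OF assms, of "\<lambda>x. inner (v x) (w x)"] by simp

lemma sq_summable_reindex:
  assumes "bij_betw f X X" "sq_summable X v"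
  shows "sq_summable X (\<lambda>x. v (f x))"
  using assms summable_on_reindex_bij_betw[OF assms(1), of "\<lambda>x. (norm (v x))\<^sup>2"]
  unfolding sq_summable_def by simp

lemma l2ip_abs_mono:
  fixes v w :: "'a \<Rightarrow> real"
  assumes "sq_summable X v" "sq_summable X w" "\<And>x. x \<in> X \<Longrightarrow> \<bar>v x\<bar> \<le> w x"
  shows "l2ip X v v \<le> l2ip X w w"
  unfolding l2ip_def
proof (rule infsum_mono)
  fix x assume "x \<in> X"
  then have "\<bar>v x\<bar> \<le> \<bar>w x\<bar>" using assms(3) by force
  then show "inner (v x) (v x) \<le> inner (w x) (w x)"
    by (simp add: abs_le_square_iff power2_eq_square)
qed (use assms sq_summable_inner in blast)+

section \<open>Limits of set functions by compactness\<close>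

text \<open>By Tychonoff the cube of all set functions with values in \<open>{0..1}\<close> is
  compact. A finer filter along which all \<open>M i A\<close> converge at once does the work of an
  ultrafilter in the constructions of means.\<close>

lemma cluster_mean:
  fixes M :: "'i \<Rightarrow> 'a set \<Rightarrow> real"
  assumes "F \<noteq> bot" "\<And>i A. M i A \<in> {0..1}"
  obtains m F' where "F' \<le> F" "F' \<noteq> bot" "\<And>A. ((\<lambda>i. M i A) \<longlongrightarrow> m A) F'"
proof -
  let ?U = "PiE UNIV (\<lambda>_::'a set. {0..1::real})"
  have "compactin (product_topology (\<lambda>_. euclidean) UNIV) ?U"
    by (subst compactin_PiE) auto
  then have comp: "compact ?U" by (simp add: euclidean_product_topology)
  have "eventually (\<lambda>f. f \<in> ?U) (filtermap M F)"
    unfolding eventually_filtermap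
    using assms(2) by (intro always_eventually) (auto simp: PiE_iff)
  moreover have "filtermap M F \<noteq> bot" using assms(1) by (simp add: filtermap_bot_iff)
  ultimately obtain m where m: "inf (nhds m) (filtermap M F) \<noteq> bot"
    using comp unfolding compact_filter by blast
  \<comment> \<open>Intersecting with the preimages of the neighbourhoods of \<open>m\<close> forces
    convergence to \<open>m\<close>; this filter is proper because \<open>m\<close> is a cluster
    point.\<close>
  define F' where "F' = inf F (filtercomap M (nhds m))"
  have "F' \<noteq> bot"
  proof
    assume "F' = bot"
    then have "eventually (\<lambda>_. False) F'" by simp
    then obtain P Q where PQ: "eventually P F" "eventually Q (filtercomap M (nhds m))"
      "\<And>x. P x \<Longrightarrow> Q x \<Longrightarrow> False"
      unfolding F'_def eventually_inf by blast
    obtain R where R: "eventually R (nhds m)" "\<And>x. R (M x) \<Longrightarrow> Q x"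
      using PQ(2) unfolding eventually_filtercomap by blast
    have "eventually (\<lambda>f. \<not> R f) (filtermap M F)"
      unfolding eventually_filtermap
      by (rule eventually_mono[OF PQ(1)]) (use PQ R in blast)
    then have "eventually (\<lambda>_. False) (inf (nhds m) (filtermap M F))"
      unfolding eventually_inf using R(1) by blast
    then show False using m by (simp add: trivial_limit_def)
  qed
  moreover have "((\<lambda>i. M i A) \<longlongrightarrow> m A) F'" for A
  proof -
    have "filterlim M (nhds m) F'"
      unfolding F'_def by (meson filterlim_filtercomap filterlim_mono inf_le2 order_refl)
    moreover have "continuous_on UNIV (\<lambda>f::'a set \<Rightarrow> real. f A)" by simp
    then have "((\<lambda>f::'a set \<Rightarrow> real. f A) \<longlongrightarrow> m A) (nhds m)"
      by (simp add: continuous_on_def tendsto_nhds_iff)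
    ultimately show ?thesis by (rule filterlim_compose[rotated])
  qed
  moreover have "F' \<le> F" by (simp add: F'_def)
  ultimately show thesis using that by blast
qed

section \<open>Twisted translations by words\<close>

text \<open>Log-convexity says that the ratios of successive terms never decrease. A first ratio
  \<open>t > R\<close> would force growth at least like \<open>t ^ n\<close>, against the bound
  \<open>C * R ^ n\<close>, whatever \<open>C\<close> is.\<close>

lemma log_convex_growth:
  fixes b :: "nat \<Rightarrow> real"
  assumes nonneg: "\<And>n. 0 \<le> b n"
    and conv: "\<And>n. (b (Suc n))\<^sup>2 \<le> b n * b (Suc (Suc n))"
    and le: "\<And>n. b n \<le> C * R ^ n" and R: "0 < R"
  shows "b 1 \<le> R * b 0"
proof (rule ccontr)
  assume "\<not> ?thesis"
  then have gt: "b 1 > R * b 0" by simp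
  have b0: "b 0 > 0"
  proof (rule ccontr)
    assume "\<not> b 0 > 0"
    then have "b 0 = 0" using nonneg[of 0] by linarith
    then show False using conv[of 0] gt by simp
  qed
  define t where "t = b 1 / b 0"
  have tR: "t > R" using gt b0 by (simp add: t_def field_simps)
  then have t: "t > 0" using R by linarith
  have step: "b n > 0 \<and> b (Suc n) \<ge> t * b n" for n
  proof (induction n)
    case 0
    then show ?case using b0 by (simp add: t_def)
  next
    case (Suc n)
    have p: "b (Suc n) > 0" using Suc t by (smt (verit) mult_pos_pos)
    have "b n * (t * b (Suc n)) \<le> b (Suc n) * b (Suc n)"
      using Suc p by (metis mult.assoc mult.commute mult_le_cancel_right_pos)
    also have "\<dots> \<le> b n * b (Suc (Suc n))" using conv[of n] by (simp add: power2_eq_square)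
    finally show ?case using p Suc by simp
  qed
  have lower: "t ^ n * b 0 \<le> b n" for n
  proof (induction n)
    case (Suc n)
    have "t ^ Suc n * b 0 \<le> t * b n" using Suc t by (simp add: mult.assoc)
    also have "\<dots> \<le> b (Suc n)" using step by blast
    finally show ?case .
  qed simp
  have bd: "(t / R) ^ n \<le> C / b 0" for n
  proof -
    have "t ^ n * b 0 \<le> C * R ^ n" using lower[of n] le[of n] by linarith
    then show ?thesis using R b0 by (simp add: power_divide field_simps)
  qed
  obtain n where "C / b 0 < (t / R) ^ n"
    using real_arch_pow[of "t / R" "C / b 0"] tR R by auto
  with bd[of n] show False by linarith
qed

section \<open>Words and their products\<close>

text \<open>Sums run over words and not over their products, so that group elements are counted with
  multiplicity and powers of a sum of generators expand exactly.\<close>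

definition words :: "'a set \<Rightarrow> nat \<Rightarrow> 'a list set" where
  "words S n = {w. set w \<subseteq> S \<and> length w = n}"

lemma finite_words [simp]: "finite S \<Longrightarrow> finite (words S n)"
  unfolding words_def by (rule finite_lists_length_eq)

lemma card_words: "finite S \<Longrightarrow> card (words S n) = card S ^ n"
  unfolding words_def by (rule card_lists_length_eq)

lemma words_0 [simp]: "words S 0 = {[]}"
  by (auto simp: words_def)

lemma sum_words_Suc:
  fixes f :: "'a list \<Rightarrow> 'b::comm_monoid_add"
  shows "(\<Sum>w\<in>words S (Suc n). f w) = (\<Sum>s\<in>S. \<Sum>w\<in>words S n. f (s # w))"
proof -
  have "words S (Suc n) = (\<lambda>(s, w). s # w) ` (S \<times> words S n)"
    by (auto simp: words_def image_iff length_Suc_conv)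
  moreover have "inj_on (\<lambda>(s, w). s # w) (S \<times> words S n)" by (auto simp: inj_on_def)
  ultimately have "(\<Sum>w\<in>words S (Suc n). f w) = (\<Sum>p\<in>S \<times> words S n. f (case p of (s, w) \<Rightarrow> s # w))"
    by (simp only: sum.reindex o_def)
  then show ?thesis by (simp add: sum.cartesian_product case_prod_beta)
qed

definition word_prod :: "('g, 'm) monoid_scheme \<Rightarrow> 'g list \<Rightarrow> 'g" where
  "word_prod G w = foldr (\<otimes>\<^bsub>G\<^esub>) w \<one>\<^bsub>G\<^esub>"

lemma word_prod_simps [simp]:
  "word_prod G [] = \<one>\<^bsub>G\<^esub>" "word_prod G (s # w) = s \<otimes>\<^bsub>G\<^esub> word_prod G w"
  by (simp_all add: word_prod_def)

lemma (in monoid) word_prod_closed: "set w \<subseteq> carrier G \<Longrightarrow> word_prod G w \<in> carrier G"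
  by (induction w) auto

lemma (in monoid) word_prod_words_closed:
  "S \<subseteq> carrier G \<Longrightarrow> w \<in> words S n \<Longrightarrow> word_prod G w \<in> carrier G"
  by (rule word_prod_closed) (auto simp: words_def)

section \<open>Orthogonal representations\<close>

lemma orthogonal_rep_inner:
  "orthogonal_rep G \<pi> \<Longrightarrow> g \<in> carrier G \<Longrightarrow> inner (\<pi> g a) (\<pi> g b) = inner a b"
  by (simp add: orthogonal_rep_def orthogonal_transformation_def)

lemma orthogonal_rep_linear: "orthogonal_rep G \<pi> \<Longrightarrow> g \<in> carrier G \<Longrightarrow> linear (\<pi> g)"
  by (simp add: orthogonal_rep_def orthogonal_transformation_def)

lemma orthogonal_rep_norm:
  "orthogonal_rep G \<pi> \<Longrightarrow> g \<in> carrier G \<Longrightarrow> norm (\<pi> g a) = norm a"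
  by (simp add: norm_eq_sqrt_inner orthogonal_rep_inner)

lemma orthogonal_rep_mult:
  "orthogonal_rep G \<pi> \<Longrightarrow> g \<in> carrier G \<Longrightarrow> h \<in> carrier G \<Longrightarrow> \<pi> (g \<otimes>\<^bsub>G\<^esub> h) a = \<pi> g (\<pi> h a)"
  by (simp add: orthogonal_rep_def)

text \<open>The operator of the unit is idempotent, and a surjective idempotent map is the
  identity.\<close>

lemma orthogonal_rep_one:
  assumes "group G" "orthogonal_rep G \<pi>"
  shows "\<pi> \<one>\<^bsub>G\<^esub> a = a"
proof -
  interpret group G by fact
  obtain b where "a = \<pi> \<one>\<^bsub>G\<^esub> b"
    using assms(2) unfolding orthogonal_rep_def by (metis one_closed surjD)
  then show ?thesis using orthogonal_rep_mult[OF assms(2), of "\<one>\<^bsub>G\<^esub>" "\<one>\<^bsub>G\<^esub>" b] by simp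
qed

lemma orthogonal_rep_inner_swap:
  assumes "group G" "orthogonal_rep G \<pi>" "g \<in> carrier G" "h \<in> carrier G"
  shows "inner (\<pi> g a) (\<pi> h b) = inner (\<pi> (inv\<^bsub>G\<^esub> h \<otimes>\<^bsub>G\<^esub> g) a) b"
proof -
  interpret group G by fact
  have "\<pi> g a = \<pi> h (\<pi> (inv\<^bsub>G\<^esub> h \<otimes>\<^bsub>G\<^esub> g) a)"
    using assms orthogonal_rep_mult[of G \<pi> h "inv\<^bsub>G\<^esub> h \<otimes>\<^bsub>G\<^esub> g" a] by (simp add: m_assoc[symmetric])
  then show ?thesis using orthogonal_rep_inner assms by metis
qed

section \<open>Group actions twisted by a representation\<close>

text \<open>Two instances matter: left multiplication with trivial real coefficients, which yields
  the regular representation, and conjugation with coefficients in \<pi>.\<close>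

locale twisted_action = group G for G (structure) +
  fixes X :: "'x set" and \<alpha> :: "'a \<Rightarrow> 'x \<Rightarrow> 'x"
    and \<pi> :: "'a \<Rightarrow> 'h \<Rightarrow> 'h::{real_inner,complete_space}"
  assumes rep: "orthogonal_rep G \<pi>"
    and act_closed: "\<And>g x. g \<in> carrier G \<Longrightarrow> x \<in> X \<Longrightarrow> \<alpha> g x \<in> X"
    and act_one: "\<And>x. x \<in> X \<Longrightarrow> \<alpha> \<one> x = x"
    and act_mult: "\<And>g h x. g \<in> carrier G \<Longrightarrow> h \<in> carrier G \<Longrightarrow> x \<in> X \<Longrightarrow> \<alpha> (g \<otimes> h) x = \<alpha> g (\<alpha> h x)"
begin

text \<open>The permutation representation on \<open>X\<close> tensored with \<pi>. The value 0 off
  \<open>X\<close> lets the composition laws be equations between functions.\<close>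

definition translate :: "'a \<Rightarrow> ('x \<Rightarrow> 'h) \<Rightarrow> 'x \<Rightarrow> 'h" where
  "translate g v = (\<lambda>x. if x \<in> X then \<pi> g (v (\<alpha> (inv g) x)) else 0)"

text \<open>For \<open>S\<close> inside the group and functions vanishing off \<open>X\<close>, this
  is the \<open>n\<close>-th power of the operator that sums \<open>translate s\<close> over
  \<open>S\<close>; see \<open>word_sum_Suc\<close>.\<close>

definition word_sum :: "'a set \<Rightarrow> nat \<Rightarrow> ('x \<Rightarrow> 'h) \<Rightarrow> 'x \<Rightarrow> 'h" where
  "word_sum S n v = (\<lambda>x. \<Sum>w\<in>words S n. translate (word_prod G w) v x)"

lemma act_inv: "g \<in> carrier G \<Longrightarrow> x \<in> X \<Longrightarrow> \<alpha> g (\<alpha> (inv g) x) = x"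
  "g \<in> carrier G \<Longrightarrow> x \<in> X \<Longrightarrow> \<alpha> (inv g) (\<alpha> g x) = x"
  by (metis act_mult act_one inv_closed r_inv, metis act_mult act_one inv_closed l_inv)

lemma bij_act: "g \<in> carrier G \<Longrightarrow> bij_betw (\<alpha> g) X X"
  by (rule bij_betw_byWitness[where f' = "\<alpha> (inv g)"]) (auto simp: act_inv act_closed)

lemma sq_summable_translate:
  assumes "g \<in> carrier G" "sq_summable X v"
  shows "sq_summable X (translate g v)"
proof -
  have "sq_summable X (\<lambda>x. v (\<alpha> (inv g) x))"
    by (rule sq_summable_reindex) (use assms bij_act in auto)
  then show ?thesis
    unfolding sq_summable_def translate_def
    by (rule summable_on_cong[THEN iffD1, rotated]) (simp add: orthogonal_rep_norm[OF rep] assms)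
qed

lemma l2ip_translate:
  assumes "g \<in> carrier G"
  shows "l2ip X (translate g v) (translate g w) = l2ip X v w"
proof -
  have "l2ip X (translate g v) (translate g w)
      = l2ip X (\<lambda>x. v (\<alpha> (inv g) x)) (\<lambda>x. w (\<alpha> (inv g) x))"
    unfolding l2ip_def translate_def
    by (rule infsum_cong) (simp add: orthogonal_rep_inner[OF rep] assms)
  also have "\<dots> = l2ip X v w" by (rule l2ip_reindex) (use assms bij_act in auto)
  finally show ?thesis .
qed

lemma translate_mult:
  assumes "g \<in> carrier G" "h \<in> carrier G"
  shows "translate g (translate h v) = translate (g \<otimes> h) v"
  using assms
  by (auto simp: translate_def fun_eq_iff act_closed act_mult inv_mult_group
      orthogonal_rep_mult[OF rep])

lemma translate_one: "(\<And>x. x \<notin> X \<Longrightarrow> v x = 0) \<Longrightarrow> translate \<one> v = v"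
  by (auto simp: translate_def fun_eq_iff act_one orthogonal_rep_one[OF is_group rep])

lemma translate_sum:
  assumes "g \<in> carrier G"
  shows "translate g (\<lambda>x. \<Sum>i\<in>I. v i x) = (\<lambda>x. \<Sum>i\<in>I. translate g (v i) x)"
  by (auto simp: translate_def fun_eq_iff linear_sum[OF orthogonal_rep_linear[OF rep assms]])

lemma l2ip_translate_adjoint:
  assumes "g \<in> carrier G"
  shows "l2ip X (translate g v) w = l2ip X v (translate (inv g) w)"
proof -
  have "l2ip X (translate g v) w = l2ip X (translate g v) (translate g (translate (inv g) w))"
    by (rule l2ip_cong)
      (use assms in \<open>auto simp: translate_mult, auto simp: translate_def act_one orthogonal_rep_one[OF is_group rep]\<close>)
  then show ?thesis using assms by (simp add: l2ip_translate)
qed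

lemma word_sum_0: "(\<And>x. x \<notin> X \<Longrightarrow> v x = 0) \<Longrightarrow> word_sum S 0 v = v"
  by (simp add: word_sum_def translate_one)

lemma word_sum_Suc:
  assumes "S \<subseteq> carrier G"
  shows "word_sum S (Suc n) v = (\<lambda>x. \<Sum>s\<in>S. translate s (word_sum S n v) x)"
proof
  fix x
  have "(\<Sum>s\<in>S. \<Sum>w\<in>words S n. translate (s \<otimes> word_prod G w) v x)
      = (\<Sum>s\<in>S. translate s (word_sum S n v) x)"
  proof (rule sum.cong)
    fix s assume s: "s \<in> S"
    have "translate s (word_sum S n v) x = (\<Sum>w\<in>words S n. translate s (translate (word_prod G w) v) x)"
      unfolding word_sum_def using s assms by (subst translate_sum) auto
    also have "\<dots> = (\<Sum>w\<in>words S n. translate (s \<otimes> word_prod G w) v x)"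
      using s assms by (intro sum.cong) (auto simp: translate_mult word_prod_words_closed subset_iff)
    finally show "(\<Sum>w\<in>words S n. translate (s \<otimes> word_prod G w) v x) = translate s (word_sum S n v) x" ..
  qed simp
  then show "word_sum S (Suc n) v x = (\<Sum>s\<in>S. translate s (word_sum S n v) x)"
    by (simp add: word_sum_def sum_words_Suc)
qed

lemma word_sum_outside: "x \<notin> X \<Longrightarrow> word_sum S n v x = 0"
  by (simp add: word_sum_def translate_def)

lemma sq_summable_word_sum:
  "S \<subseteq> carrier G \<Longrightarrow> sq_summable X v \<Longrightarrow> sq_summable X (word_sum S n v)"
  unfolding word_sum_def
  by (intro sq_summable_sum sq_summable_translate) (auto simp: word_prod_words_closed)

text \<open>The adjoint of a translation is the translation by the inverse, so a sum over an
  inverse-closed set is self-adjoint.\<close>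

lemma l2ip_gen_sum_adjoint:
  assumes S: "S \<subseteq> carrier G" "\<And>s. s \<in> S \<Longrightarrow> inv s \<in> S"
    and v: "sq_summable X v" and w: "sq_summable X w"
  shows "l2ip X (\<lambda>x. \<Sum>s\<in>S. translate s v x) w = l2ip X v (\<lambda>x. \<Sum>s\<in>S. translate s w x)"
proof -
  have S': "s \<in> carrier G" if "s \<in> S" for s using that S by auto
  have "l2ip X (\<lambda>x. \<Sum>s\<in>S. translate s v x) w = (\<Sum>s\<in>S. l2ip X (translate s v) w)"
    by (rule l2ip_sum_left) (use S' v w sq_summable_translate in auto)
  also have "\<dots> = (\<Sum>s\<in>S. l2ip X v (translate (inv s) w))"
    using S' by (intro sum.cong) (auto simp: l2ip_translate_adjoint)
  also have "\<dots> = (\<Sum>s\<in>S. l2ip X v (translate s w))"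
    by (rule sum.reindex_bij_witness[where i = "m_inv G" and j = "m_inv G"]) (use S S' in auto)
  also have "\<dots> = l2ip X v (\<lambda>x. \<Sum>s\<in>S. translate s w x)"
    by (rule l2ip_sum_right[symmetric]) (use S' v w sq_summable_translate in auto)
  finally show ?thesis .
qed

text \<open>Self-adjointness moves the factors across the inner product one at a time.\<close>

lemma l2ip_word_sum_word_sum:
  assumes S: "S \<subseteq> carrier G" "\<And>s. s \<in> S \<Longrightarrow> inv s \<in> S"
    and v: "sq_summable X v" "\<And>x. x \<notin> X \<Longrightarrow> v x = 0"
  shows "l2ip X (word_sum S n v) (word_sum S m v) = l2ip X (word_sum S (n + m) v) v"
proof (induction m arbitrary: n)
  case 0
  then show ?case using v by (simp add: word_sum_0)
next
  case (Suc m)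
  have "l2ip X (word_sum S n v) (word_sum S (Suc m) v) = l2ip X (word_sum S (Suc n) v) (word_sum S m v)"
    using S v by (simp add: word_sum_Suc l2ip_gen_sum_adjoint sq_summable_word_sum)
  then show ?case using Suc[of "Suc n"] by simp
qed

text \<open>The squared norms of the iterates form a log-convex sequence, so
  \<open>log_convex_growth\<close> applies. The gain is that a decay estimate with a constant
  \<open>C\<close> depending on \<open>v\<close> becomes a one-step bound with constant exactly
  \<open>R\<close>.\<close>

lemma word_sum_growth_imp_contraction:
  assumes S: "S \<subseteq> carrier G" "\<And>s. s \<in> S \<Longrightarrow> inv s \<in> S"
    and v: "sq_summable X v" "\<And>x. x \<notin> X \<Longrightarrow> v x = 0"
    and le: "\<And>n. l2ip X (word_sum S (n + n) v) v \<le> C * R ^ n" and R: "R > 0"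
  shows "l2ip X (word_sum S (Suc 0) v) (word_sum S (Suc 0) v) \<le> R * l2ip X v v"
proof -
  let ?b = "\<lambda>n. l2ip X (word_sum S n v) (word_sum S n v)"
  have "?b 1 \<le> R * ?b 0"
  proof (rule log_convex_growth)
    show "?b n \<le> C * R ^ n" for n using le[of n] l2ip_word_sum_word_sum[OF S v, of n n] by simp
    show "(?b (Suc n))\<^sup>2 \<le> ?b n * ?b (Suc (Suc n))" for n
    proof -
      \<comment> \<open>Both sides equal the coefficient of the power \<open>2 * n + 2\<close>;
        Cauchy-Schwarz on the unequal split gives log-convexity.\<close>
      have "?b (Suc n) = l2ip X (word_sum S n v) (word_sum S (Suc (Suc n)) v)"
        using l2ip_word_sum_word_sum[OF S v, of "Suc n" "Suc n"]
          l2ip_word_sum_word_sum[OF S v, of n "Suc (Suc n)"] by simp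
      then show ?thesis
        using l2ip_Cauchy_Schwarz[of X "word_sum S n v" "word_sum S (Suc (Suc n)) v"] S v
        by (simp add: sq_summable_word_sum)
    qed
  qed (use R in auto)
  then show ?thesis using v by (simp add: word_sum_0)
qed

text \<open>\<open>P\<close> is a class of functions stable under the operator on which the one-step
  bound is known: square-summable functions in one use, finitely supported ones in the
  other.\<close>

lemma word_sum_contraction_power:
  assumes S: "S \<subseteq> carrier G" and R: "R \<ge> 0" and v0: "\<And>x. x \<notin> X \<Longrightarrow> v x = 0"
    and P: "P v" "\<And>u. P u \<Longrightarrow> P (word_sum S (Suc 0) u)"
    and le: "\<And>u. P u \<Longrightarrow> (\<And>x. x \<notin> X \<Longrightarrow> u x = 0) \<Longrightarrow>
       l2ip X (word_sum S (Suc 0) u) (word_sum S (Suc 0) u) \<le> R * l2ip X u u"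
  shows "l2ip X (word_sum S n v) (word_sum S n v) \<le> R ^ n * l2ip X v v"
proof -
  have eq: "word_sum S (Suc n) v = word_sum S (Suc 0) (word_sum S n v)" for n
    using S by (simp add: word_sum_Suc word_sum_0 word_sum_outside)
  have "P (word_sum S n v) \<and>
     l2ip X (word_sum S n v) (word_sum S n v) \<le> R ^ n * l2ip X v v"
  proof (induction n)
    case 0
    then show ?case using P v0 by (simp add: word_sum_0)
  next
    case (Suc n)
    have "l2ip X (word_sum S (Suc n) v) (word_sum S (Suc n) v)
       \<le> R * l2ip X (word_sum S n v) (word_sum S n v)"
      unfolding eq by (rule le) (use Suc word_sum_outside in auto)
    also have "\<dots> \<le> R * (R ^ n * l2ip X v v)"
      using Suc R by (intro mult_left_mono) auto
    finally show ?case using P(2) Suc by (simp add: eq mult.assoc)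
  qed
  then show ?thesis by simp
qed

end

section \<open>Mass on subsets, and the regular representation as a twisted action\<close>

lemma sq_summable_subset: "sq_summable X v \<Longrightarrow> A \<subseteq> X \<Longrightarrow> sq_summable A v"
  unfolding sq_summable_def by (rule summable_on_subset)

lemma l2ip_subset_le:
  assumes "sq_summable X v" "A \<subseteq> X"
  shows "l2ip A v v \<le> l2ip X v v"
proof -
  have "sq_summable A v" using assms by (rule sq_summable_subset)
  then show ?thesis
    unfolding l2ip_def
    by (intro infsum_mono2 sq_summable_inner) (use assms in simp_all)
qed

lemma abs_l2ip_le:
  assumes "sq_summable X v" "sq_summable X w"
  shows "\<bar>l2ip X v w\<bar> \<le> sqrt (l2ip X v v) * sqrt (l2ip X w w)"
  using real_sqrt_le_mono[OF l2ip_Cauchy_Schwarz[OF assms]] by (simp add: real_sqrt_mult)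

text \<open>The difference of the two masses is the inner product on \<open>A\<close> of
  \<open>h - f\<close> with \<open>h + f\<close>, and Cauchy-Schwarz bounds each half. Thus a vector
  moved only slightly has an almost invariant distribution of mass.\<close>

lemma abs_l2ip_diff_le:
  assumes f: "sq_summable X f" and h: "sq_summable X h" and A: "A \<subseteq> X"
    and fh: "l2ip X f f \<le> c" "l2ip X h h \<le> c"
    and d: "l2ip X (\<lambda>x. h x - f x) (\<lambda>x. h x - f x) \<le> d"
  shows "\<bar>l2ip A h h - l2ip A f f\<bar> \<le> 2 * (sqrt d * sqrt c)"
proof -
  note sub = sq_summable_subset[OF _ A]
  let ?u = "\<lambda>x. h x - f x"
  have u: "sq_summable X ?u" using f h sq_summable_diff by blast
  have bound: "\<bar>l2ip A ?u k\<bar> \<le> sqrt d * sqrt c" if "sq_summable X k" "l2ip X k k \<le> c" for k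
  proof -
    have "\<bar>l2ip A ?u k\<bar> \<le> sqrt (l2ip A ?u ?u) * sqrt (l2ip A k k)"
      by (rule abs_l2ip_le) (use sub u that in auto)
    also have "\<dots> \<le> sqrt d * sqrt c"
      using l2ip_subset_le[OF u A] l2ip_subset_le[OF that(1) A] d that(2)
        order_trans[OF l2ip_self_nonneg d]
      by (intro mult_mono) auto
    finally show ?thesis .
  qed
  have "l2ip A h h - l2ip A f f = l2ip A ?u h + l2ip A ?u f"
    using sub[OF f] sub[OF h] by (simp add: l2ip_diff_left l2ip_commute[of A f h])
  then show ?thesis using bound[OF f fh(1)] bound[OF h fh(2)] by linarith
qed

lemma twisted_action_left_regular:
  assumes "group G"
  shows "twisted_action G (carrier G) (\<otimes>\<^bsub>G\<^esub>) (\<lambda>_ a::real. a)"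
proof -
  interpret group G by fact
  show ?thesis
    by unfold_locales (auto simp: orthogonal_rep_def orthogonal_transformation_def m_assoc
        fun_eq_iff surj_def)
qed

lemma translate_left_regular:
  assumes "group G"
  shows "twisted_action.translate G (carrier G) (\<otimes>\<^bsub>G\<^esub>) (\<lambda>_ a::real. a) g f = left_regular G g f"
  using twisted_action.translate_def[OF twisted_action_left_regular[OF assms]]
  by (simp add: left_regular_def)

lemma ell2_iff: "f \<in> ell2 G \<longleftrightarrow> (\<forall>x. x \<notin> carrier G \<longrightarrow> f x = 0) \<and> sq_summable (carrier G) f"
  by (simp add: ell2_def sq_summable_def)

lemma ell2_inner_eq: "ell2_inner G f h = l2ip (carrier G) f h"
  by (simp add: ell2_inner_def l2ip_def)

section \<open>The norm gap of a non-amenable group\<close>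

text \<open>Contrapositive of the construction of a mean from almost invariant vectors: if every
  finite set could move some vector arbitrarily little, the normalized masses of the squares of such
  vectors would cluster at a left invariant mean.\<close>

lemma nonamenable_displacement:
  fixes G (structure)
  assumes "group G" and na: "\<not> amenable G"
  obtains S \<epsilon> where "finite S" "S \<subseteq> carrier G" "0 < \<epsilon>" "\<epsilon> \<le> 1"
    "\<And>f. f \<in> ell2 G \<Longrightarrow> \<exists>s\<in>S. \<epsilon> * l2ip (carrier G) f f \<le>
       l2ip (carrier G) (\<lambda>x. left_regular G s f x - f x) (\<lambda>x. left_regular G s f x - f x)"
proof (rule ccontr)
  note that_thesis = that
  interpret group G by (rule assms)
  interpret reg: twisted_action G "carrier G" "(\<otimes>)" "\<lambda>_ a::real. a"
    by (rule twisted_action_left_regular) (rule is_group)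
  note tr = translate_left_regular[OF is_group]
  let ?X = "carrier G"
  let ?d = "\<lambda>s f. l2ip ?X (\<lambda>x. left_regular G s f x - f x) (\<lambda>x. left_regular G s f x - f x)"
  assume "\<not> thesis"
  then have ex: "\<exists>f\<in>ell2 G. \<forall>s\<in>S. ?d s f < \<epsilon> * l2ip ?X f f"
    if "finite S" "S \<subseteq> ?X" "0 < \<epsilon>" "\<epsilon> \<le> 1" for S \<epsilon>
    using that_thesis[OF that] by (meson not_le)
  \<comment> \<open>Inserting \<open>\<one>\<close> makes the strict inequality apply at least once,
    and this forces the chosen vector to be non-zero.\<close>
  define f where "f = (\<lambda>S n. SOME f. f \<in> ell2 G \<and>
      (\<forall>s\<in>insert \<one> S. ?d s f < inverse (real (Suc n)) * l2ip ?X f f))"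
  have f: "f S n \<in> ell2 G \<and>
      (\<forall>s\<in>insert \<one> S. ?d s (f S n) < inverse (real (Suc n)) * l2ip ?X (f S n) (f S n))"
    if "finite S" "S \<subseteq> ?X" for S n
  proof -
    have "\<exists>f\<in>ell2 G. \<forall>s\<in>insert \<one> S. ?d s f < inverse (real (Suc n)) * l2ip ?X f f"
      by (rule ex) (use that in \<open>simp_all add: inverse_le_1_iff\<close>)
    then have "\<exists>f. f \<in> ell2 G \<and>
      (\<forall>s\<in>insert \<one> S. ?d s f < inverse (real (Suc n)) * l2ip ?X f f)" by blast
    from someI_ex[OF this] show ?thesis unfolding f_def .
  qed
  have sq: "sq_summable ?X (f S n)" if "finite S" "S \<subseteq> ?X" for S n
    using f[OF that] by (simp add: ell2_iff)
  have pos: "l2ip ?X (f S n) (f S n) > 0" if "finite S" "S \<subseteq> ?X" for S n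
  proof -
    have "0 \<le> ?d \<one> (f S n)" by simp
    also have "\<dots> < inverse (real (Suc n)) * l2ip ?X (f S n) (f S n)" using f[OF that, of n] by simp
    finally show ?thesis by (metis inverse_positive_iff_positive of_nat_0_less_iff zero_less_Suc zero_less_mult_pos)
  qed
  \<comment> \<open>The share of the mass of \<open>f S n\<close> that lies in \<open>A\<close>. The
    default 0 keeps all values in \<open>{0..1}\<close>, as \<open>cluster_mean\<close>
    requires.\<close>
  define M where "M = (\<lambda>(n::nat, S) A. if finite S \<and> S \<subseteq> ?X
     then l2ip (A \<inter> ?X) (f S n) (f S n) / l2ip ?X (f S n) (f S n) else 0)"
  define F where "F = sequentially \<times>\<^sub>F finite_subsets_at_top ?X"
  have "F \<noteq> bot" by (simp add: F_def prod_filter_eq_bot)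
  moreover have M01: "M i A \<in> {0..1}" for i A
  proof (cases i)
    case (Pair n S)
    show ?thesis
    proof (cases "finite S \<and> S \<subseteq> ?X")
      case True
      then show ?thesis
        using pos[of S n] l2ip_subset_le[OF sq[of S n], of "A \<inter> ?X"] by (simp add: M_def Pair)
    qed (auto simp: M_def Pair)
  qed
  ultimately obtain m F' where F': "F' \<le> F" "F' \<noteq> bot" and m: "\<And>A. ((\<lambda>i. M i A) \<longlongrightarrow> m A) F'"
    using cluster_mean by metis
  have ev: "eventually (\<lambda>(n, S). finite S \<and> S \<subseteq> ?X \<and> T \<subseteq> S) F'" if "finite T" "T \<subseteq> ?X" for T
  proof -
    have "eventually (\<lambda>S. finite S \<and> S \<subseteq> ?X \<and> T \<subseteq> S) (finite_subsets_at_top ?X)"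
      unfolding eventually_finite_subsets_at_top using that by blast
    then have "eventually (\<lambda>i. finite (snd i) \<and> snd i \<subseteq> ?X \<and> T \<subseteq> snd i) F"
      using filterlim_snd[of "finite_subsets_at_top ?X" sequentially] unfolding filterlim_iff F_def by blast
    then have "eventually (\<lambda>i. finite (snd i) \<and> snd i \<subseteq> ?X \<and> T \<subseteq> snd i) F'"
      by (rule filter_leD[OF F'(1)])
    then show ?thesis by (simp add: case_prod_unfold)
  qed
  have small: "((\<lambda>i. 2 * sqrt (inverse (real (Suc (fst i))))) \<longlongrightarrow> 0) F'"
  proof -
    have "(\<lambda>n. 2 * sqrt (inverse (real (Suc n)))) \<longlonglongrightarrow> 2 * sqrt 0"
      by (intro tendsto_intros LIMSEQ_inverse_real_of_nat)
    moreover have "filterlim fst sequentially F'"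
      using F'(1) filterlim_fst filterlim_mono unfolding F_def by blast
    ultimately show ?thesis using filterlim_compose by fastforce
  qed
  have "fin_additive_prob ?X m"
    unfolding fin_additive_prob_def additive_def
  proof (intro conjI allI ballI impI)
    fix A
    show "0 \<le> m A"
      by (rule tendsto_lowerbound[OF m]) (use M01 F' in auto)
  next
    have "eventually (\<lambda>i. M i ?X = 1) F'"
    proof (rule eventually_mono[OF ev[of "{}"]])
      fix i :: "nat \<times> 'a set"
      assume "case i of (n, S) \<Rightarrow> finite S \<and> S \<subseteq> ?X \<and> {} \<subseteq> S"
      then obtain n S where "i = (n, S)" "finite S" "S \<subseteq> ?X" by (cases i) auto
      then show "M i ?X = 1" using pos[of S n] by (simp add: M_def)
    qed auto
    then have "((\<lambda>i. M i ?X) \<longlongrightarrow> 1) F'" by (rule tendsto_eventually)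
    then show "m ?X = 1" using m F'(2) tendsto_unique by blast
  next
    fix A B assume A: "A \<in> Pow ?X" and B: "B \<in> Pow ?X" and AB: "A \<inter> B = {}"
    have "M i (A \<union> B) = M i A + M i B" for i
    proof (cases i)
      case (Pair n S)
      show ?thesis
      proof (cases "finite S \<and> S \<subseteq> ?X")
        case True
        have i: "A \<inter> ?X = A" "B \<inter> ?X = B" "(A \<union> B) \<inter> ?X = A \<union> B" using A B by auto
        have "sq_summable A (f S n)" "sq_summable B (f S n)"
          using True A B sq sq_summable_subset by blast+
        then have "l2ip (A \<union> B) (f S n) (f S n) = l2ip A (f S n) (f S n) + l2ip B (f S n) (f S n)"
          unfolding l2ip_def by (intro infsum_Un_disjoint sq_summable_inner AB)
        then show ?thesis using True by (simp add: M_def Pair i add_divide_distrib)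
      next
        case False
        then have "M i C = 0" for C by (auto simp: M_def Pair)
        then show ?thesis by simp
      qed
    qed
    then have "((\<lambda>i. M i A + M i B) \<longlongrightarrow> m (A \<union> B)) F'" using m[of "A \<union> B"] by simp
    then show "m (A \<union> B) = m A + m B" using tendsto_add[OF m m] F'(2) tendsto_unique by blast
  qed
  moreover have "m ((\<lambda>x. s \<otimes> x) ` A) = m A" if s: "s \<in> ?X" and A: "A \<subseteq> ?X" for s A
  proof -
    let ?B = "(\<lambda>x. s \<otimes> x) ` A"
    have "eventually (\<lambda>i. norm (M i ?B - M i A) \<le> 2 * sqrt (inverse (real (Suc (fst i))))) F'"
    proof (rule eventually_mono[OF ev[of "{inv s}"]])
      fix i :: "nat \<times> 'a set"
      assume "case i of (n, S) \<Rightarrow> finite S \<and> S \<subseteq> ?X \<and> {inv s} \<subseteq> S"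
      then obtain n S where i: "i = (n, S)" and S: "finite S" "S \<subseteq> ?X" "inv s \<in> S"
        by (cases i) auto
      let ?f = "f S n" and ?h = "left_regular G (inv s) (f S n)"
      let ?c = "l2ip ?X ?f ?f"
      have hs: "sq_summable ?X ?h"
        using reg.sq_summable_translate[of "inv s" ?f] s sq[OF S(1,2)] by (simp add: tr)
      have hh: "l2ip ?X ?h ?h = ?c"
        using reg.l2ip_translate[of "inv s" ?f ?f] s by (simp add: tr)
      \<comment> \<open>Translating the set by \<open>s\<close> amounts to translating the vector by
        \<open>inv s\<close>, hence the requirement that \<open>inv s\<close> lie in
        \<open>S\<close>.\<close>
      have "l2ip ?B ?f ?f = l2ip A ?h ?h"
      proof -
        have inj: "inj_on (\<lambda>x. s \<otimes> x) A" using s A by (auto simp: inj_on_def subset_iff)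
        show ?thesis
          unfolding l2ip_def infsum_reindex[OF inj]
          by (rule infsum_cong) (use s A in \<open>auto simp: left_regular_def subset_iff\<close>)
      qed
      moreover have "\<bar>l2ip A ?h ?h - l2ip A ?f ?f\<bar> \<le> 2 * (sqrt (inverse (real (Suc n)) * ?c) * sqrt ?c)"
        by (rule abs_l2ip_diff_le[OF sq[OF S(1,2)] hs A])
          (use hh f[OF S(1,2), of n] S(3) in auto)
      moreover have "sqrt (inverse (real (Suc n)) * ?c) * sqrt ?c = sqrt (inverse (real (Suc n))) * ?c"
        by (simp add: real_sqrt_mult)
      ultimately have le: "\<bar>l2ip ?B ?f ?f - l2ip A ?f ?f\<bar> \<le> 2 * sqrt (inverse (real (Suc n))) * ?c"
        by simp
      have int: "?B \<inter> ?X = ?B" "A \<inter> ?X = A" using s A by auto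
      have "norm (M i ?B - M i A) = \<bar>l2ip ?B ?f ?f - l2ip A ?f ?f\<bar> / ?c"
        using S pos[OF S(1,2), of n] by (simp add: M_def i int diff_divide_distrib[symmetric])
      also have "\<dots> \<le> 2 * sqrt (inverse (real (Suc n)))"
        using le pos[OF S(1,2), of n] by (simp only: pos_divide_le_eq)
      finally show "norm (M i ?B - M i A) \<le> 2 * sqrt (inverse (real (Suc (fst i))))" by (simp add: i)
    qed (use s in auto)
    then have "((\<lambda>i. M i ?B - M i A) \<longlongrightarrow> 0) F'"
      by (rule Lim_null_comparison[OF _ small])
    moreover have "((\<lambda>i. M i ?B - M i A) \<longlongrightarrow> m ?B - m A) F'"
      by (intro tendsto_diff m)
    ultimately have "m ?B - m A = 0" using F'(2) tendsto_unique by blast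
    then show ?thesis by simp
  qed
  ultimately have "amenable G" unfolding amenable_def by blast
  then show False using na by simp
qed

text \<open>The squared norm of the sum expands into \<open>card S ^ 2\<close> inner products, each
  at most the squared norm of \<open>f\<close>. The pair formed by \<open>\<one>\<close> and an
  element displacing \<open>f\<close> falls short by the fraction \<open>\<epsilon> / 2\<close>,
  which is the gap.\<close>

lemma nonamenable_norm_gap:
  fixes G (structure)
  assumes "group G" and na: "\<not> amenable G"
  obtains S R where "finite S" "S \<subseteq> carrier G" "\<one>\<^bsub>G\<^esub> \<in> S" "\<And>s. s \<in> S \<Longrightarrow> inv\<^bsub>G\<^esub> s \<in> S"
    "0 < R" "R < real (card S) ^ 2"
    "\<And>f. f \<in> ell2 G \<Longrightarrow> l2ip (carrier G) (\<lambda>x. \<Sum>s\<in>S. left_regular G s f x)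
        (\<lambda>x. \<Sum>s\<in>S. left_regular G s f x) \<le> R * l2ip (carrier G) f f"
proof -
  interpret group G by (rule assms)
  interpret reg: twisted_action G "carrier G" "(\<otimes>)" "\<lambda>_ a::real. a"
    by (rule twisted_action_left_regular) (rule is_group)
  note tr = translate_left_regular[OF is_group]
  let ?X = "carrier G"
  obtain S0 \<epsilon> where S0: "finite S0" "S0 \<subseteq> ?X" and \<epsilon>: "0 < \<epsilon>" "\<epsilon> \<le> 1"
    and disp: "\<And>f. f \<in> ell2 G \<Longrightarrow> \<exists>s\<in>S0. \<epsilon> * l2ip ?X f f \<le>
       l2ip ?X (\<lambda>x. left_regular G s f x - f x) (\<lambda>x. left_regular G s f x - f x)"
    using nonamenable_displacement[OF assms] by blast
  define S where "S = insert \<one> (S0 \<union> m_inv G ` S0)"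
  have S: "finite S" "S \<subseteq> ?X" "\<one> \<in> S" using S0 by (auto simp: S_def)
  have Sinv: "inv s \<in> S" if "s \<in> S" for s using that S0 by (auto simp: S_def)
  have "card S \<ge> 1" using S by (metis One_nat_def Suc_leI card_gt_0_iff empty_iff)
  then have "1 \<le> (real (card S))\<^sup>2" by (metis one_le_power of_nat_1 of_nat_le_iff)
  \<comment> \<open>The bound \<open>\<epsilon> \<le> 1\<close> keeps this choice of
    \<open>R\<close> positive.\<close>
  then have R: "0 < (real (card S))\<^sup>2 - \<epsilon> / 2" "(real (card S))\<^sup>2 - \<epsilon> / 2 < (real (card S))\<^sup>2"
    using \<epsilon> by linarith+
  show thesis
  proof (rule that[OF S Sinv R])
    fix f assume f: "f \<in> ell2 G"
    let ?c = "l2ip ?X f f"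
    let ?p = "\<lambda>(s, t). l2ip ?X (left_regular G s f) (left_regular G t f)"
    have fs: "sq_summable ?X f" using f by (simp add: ell2_iff)
    have ls: "sq_summable ?X (left_regular G s f)" if "s \<in> S" for s
      using reg.sq_summable_translate[OF _ fs, of s] that S by (auto simp: tr)
    have ll: "l2ip ?X (left_regular G s f) (left_regular G s f) = ?c" if "s \<in> S" for s
      using reg.l2ip_translate[of s f f] that S by (auto simp: tr)
    have le: "?p (s, t) \<le> ?c" if "s \<in> S" "t \<in> S" for s t
      using l2ip_le_sqrt[OF ls[OF that(1)] ls[OF that(2)]] ll[OF that(1)] ll[OF that(2)] by simp
    obtain s0 where s0: "s0 \<in> S0" "\<epsilon> * ?c \<le>
       l2ip ?X (\<lambda>x. left_regular G s0 f x - f x) (\<lambda>x. left_regular G s0 f x - f x)"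
      using disp[OF f] by blast
    have s0S: "s0 \<in> S" using s0 by (simp add: S_def)
    have l1: "left_regular G \<one> f = f"
      using reg.translate_one[of f] f by (simp add: tr ell2_iff)
    \<comment> \<open>Polarization: a large displacement of \<open>f\<close> by \<open>s0\<close>
      means a small inner product of \<open>f\<close> with its translate.\<close>
    have p0: "?p (s0, \<one>) \<le> ?c - \<epsilon> / 2 * ?c"
      using s0(2) l2ip_diff_self[OF ls[OF s0S] fs] ll[OF s0S] by (simp add: l1)
    have "l2ip ?X (\<lambda>x. \<Sum>s\<in>S. left_regular G s f x) (\<lambda>x. \<Sum>s\<in>S. left_regular G s f x)
        = (\<Sum>s\<in>S. \<Sum>t\<in>S. ?p (s, t))"
      using ls by (simp add: l2ip_sum_left l2ip_sum_right sq_summable_sum)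
    also have "\<dots> = (\<Sum>z\<in>S \<times> S. ?p z)" by (simp add: sum.cartesian_product case_prod_beta)
    also have "\<dots> = ?p (s0, \<one>) + (\<Sum>z\<in>S \<times> S - {(s0, \<one>)}. ?p z)"
      using S s0S by (intro sum.remove) auto
    also have "\<dots> \<le> (?c - \<epsilon> / 2 * ?c) + (\<Sum>z\<in>S \<times> S - {(s0, \<one>)}. ?c)"
      using p0 le by (intro add_mono sum_mono) auto
    also have "(\<Sum>z\<in>S \<times> S - {(s0, \<one>)}. ?c) = (real (card S) ^ 2 - 1) * ?c"
    proof -
      have "card (S \<times> S - {(s0, \<one>)}) = card S * card S - 1"
        using S s0S by (simp add: card_Diff_singleton card_cartesian_product)
      moreover have "card S * card S \<ge> 1" using \<open>card S \<ge> 1\<close> by simp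
      ultimately show ?thesis by (simp add: power2_eq_square of_nat_diff)
    qed
    finally show "l2ip ?X (\<lambda>x. \<Sum>s\<in>S. left_regular G s f x) (\<lambda>x. \<Sum>s\<in>S. left_regular G s f x)
      \<le> (real (card S) ^ 2 - \<epsilon> / 2) * ?c" by (simp add: algebra_simps)
  qed
qed

section \<open>Weakly regular representations\<close>

lemma sum_list_sum_swap:
  fixes F :: "'a \<Rightarrow> 'b \<Rightarrow> 'c::comm_monoid_add"
  shows "(\<Sum>\<eta>\<leftarrow>L. \<Sum>z\<in>Z. F \<eta> z) = (\<Sum>z\<in>Z. \<Sum>\<eta>\<leftarrow>L. F \<eta> z)"
  by (induction L) (auto simp: sum.distrib)

text \<open>The regular representation preserves positivity, so a sum over any subset of the words
  is dominated pointwise by the full word sum applied to the absolute value of \<open>f\<close>, and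
  there the gap can be iterated. Subsets are essential for estimating single matrix coefficients
  later.\<close>

lemma left_regular_words_bound:
  fixes G (structure)
  assumes "group G" and S: "S \<subseteq> carrier G" "finite S" and R: "0 \<le> R"
    and gap: "\<And>f. f \<in> ell2 G \<Longrightarrow> l2ip (carrier G) (\<lambda>x. \<Sum>s\<in>S. left_regular G s f x)
        (\<lambda>x. \<Sum>s\<in>S. left_regular G s f x) \<le> R * l2ip (carrier G) f f"
    and W: "W \<subseteq> words S n" and f: "f \<in> ell2 G"
  shows "l2ip (carrier G) (\<lambda>x. \<Sum>w\<in>W. left_regular G (word_prod G w) f x)
      (\<lambda>x. \<Sum>w\<in>W. left_regular G (word_prod G w) f x) \<le> R ^ n * l2ip (carrier G) f f"
proof -
  interpret group G by (rule assms)
  interpret reg: twisted_action G "carrier G" "(\<otimes>)" "\<lambda>_ a::real. a"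
    by (rule twisted_action_left_regular) (rule is_group)
  note tr = translate_left_regular[OF is_group]
  let ?X = "carrier G" and ?a = "\<lambda>x. \<bar>f x\<bar>"
  have fs: "sq_summable ?X f" and f0: "\<And>x. x \<notin> ?X \<Longrightarrow> f x = 0"
    using f by (auto simp: ell2_iff)
  have a: "sq_summable ?X ?a" using fs by (simp add: sq_summable_def)
  have cl: "word_prod G w \<in> ?X" if "w \<in> words S n" for w
    using that S word_prod_words_closed by blast
  have "l2ip ?X (\<lambda>x. \<Sum>w\<in>W. left_regular G (word_prod G w) f x)
      (\<lambda>x. \<Sum>w\<in>W. left_regular G (word_prod G w) f x)
    \<le> l2ip ?X (reg.word_sum S n ?a) (reg.word_sum S n ?a)"
  proof (rule l2ip_abs_mono)
    show "sq_summable ?X (\<lambda>x. \<Sum>w\<in>W. left_regular G (word_prod G w) f x)"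
      unfolding tr[symmetric]
      by (intro sq_summable_sum reg.sq_summable_translate fs cl) (use W in auto)
    show "sq_summable ?X (reg.word_sum S n ?a)"
      by (rule reg.sq_summable_word_sum[OF S(1) a])
    fix x assume "x \<in> ?X"
    have "\<bar>\<Sum>w\<in>W. left_regular G (word_prod G w) f x\<bar> \<le> (\<Sum>w\<in>W. \<bar>left_regular G (word_prod G w) f x\<bar>)"
      by (rule sum_abs)
    also have "\<dots> \<le> (\<Sum>w\<in>words S n. \<bar>left_regular G (word_prod G w) f x\<bar>)"
      by (rule sum_mono2) (use W S in auto)
    also have "\<dots> = reg.word_sum S n ?a x"
      unfolding reg.word_sum_def tr by (rule sum.cong) (auto simp: left_regular_def)
    finally show "\<bar>\<Sum>w\<in>W. left_regular G (word_prod G w) f x\<bar> \<le> reg.word_sum S n ?a x" .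
  qed
  also have "\<dots> \<le> R ^ n * l2ip ?X ?a ?a"
  proof (rule reg.word_sum_contraction_power[where P = "sq_summable ?X"])
    fix u :: "'a \<Rightarrow> real"
    assume "sq_summable ?X u" and 0: "\<And>x. x \<notin> ?X \<Longrightarrow> u x = 0"
    then have "u \<in> ell2 G" by (simp add: ell2_iff)
    moreover have "reg.word_sum S (Suc 0) u = (\<lambda>x. \<Sum>s\<in>S. left_regular G s u x)"
      using S 0 by (simp add: reg.word_sum_Suc reg.word_sum_0 tr)
    ultimately show "l2ip ?X (reg.word_sum S (Suc 0) u) (reg.word_sum S (Suc 0) u) \<le> R * l2ip ?X u u"
      using gap by simp
  qed (use S R a f0 reg.sq_summable_word_sum in auto)
  also have "l2ip ?X ?a ?a = l2ip ?X f f" by (simp add: l2ip_def)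
  finally show ?thesis .
qed

text \<open>The squared norm is a finite combination of values of one function of positive type of
  \<pi>. Weak containment replaces these values by sums of coefficients of the regular
  representation, where \<open>left_regular_words_bound\<close> applies to each vector.\<close>

lemma weakly_ell2_words_bound:
  fixes G (structure) and \<pi> :: "_ \<Rightarrow> 'h \<Rightarrow> 'h::{real_inner,complete_space}"
  assumes "group G" and S: "S \<subseteq> carrier G" "finite S" and R: "0 \<le> R"
    and gap: "\<And>f. f \<in> ell2 G \<Longrightarrow> l2ip (carrier G) (\<lambda>x. \<Sum>s\<in>S. left_regular G s f x)
        (\<lambda>x. \<Sum>s\<in>S. left_regular G s f x) \<le> R * l2ip (carrier G) f f"
    and rep: "orthogonal_rep G \<pi>" and weak: "weakly_ell2 G \<pi>"
    and W: "W \<subseteq> words S n"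
  shows "(norm (\<Sum>w\<in>W. \<pi> (word_prod G w) \<xi>))\<^sup>2 \<le> R ^ n * (norm \<xi>)\<^sup>2"
proof (rule field_le_epsilon)
  fix e :: real assume "e > 0"
  interpret group G by (rule assms)
  interpret reg: twisted_action G "carrier G" "(\<otimes>)" "\<lambda>_ a::real. a"
    by (rule twisted_action_left_regular) (rule is_group)
  note tr = translate_left_regular[OF is_group]
  let ?X = "carrier G" and ?p = "word_prod G"
  let ?N = "real (card (W \<times> W))"
  have finW: "finite W" using W S finite_words finite_subset by metis
  have cl: "?p w \<in> ?X" if "w \<in> W" for w using that W S word_prod_words_closed by blast
  \<comment> \<open>Errors add up to \<open>?N * \<epsilon>\<close> over the pairs of words plus
    \<open>R ^ n * \<epsilon>\<close> from the unit; the summand 1 keeps the denominator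
    positive.\<close>
  define \<epsilon> where "\<epsilon> = e / (R ^ n + ?N + 1)"
  have den: "R ^ n + ?N + 1 > 0" using R by (simp add: add_nonneg_pos)
  have \<epsilon>: "\<epsilon> > 0" using den \<open>e > 0\<close> by (simp add: \<epsilon>_def)
  define g where "g = (\<lambda>(w, w'). inv ?p w' \<otimes> ?p w)"
  \<comment> \<open>The unit is among the test elements because the approximation there controls the
    total squared norm of the vectors in \<open>L\<close>.\<close>
  have T: "finite (insert \<one> (g ` (W \<times> W))) \<and> insert \<one> (g ` (W \<times> W)) \<subseteq> ?X \<and> \<epsilon> > 0"
    using finW cl \<epsilon> by (auto simp: g_def)
  obtain L where L: "set L \<subseteq> ell2 G"
    and approx: "\<And>h. h \<in> insert \<one> (g ` (W \<times> W)) \<Longrightarrow>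
      \<bar>inner (\<pi> h \<xi>) \<xi> - (\<Sum>\<eta>\<leftarrow>L. ell2_inner G (left_regular G h \<eta>) \<eta>)\<bar> < \<epsilon>"
    using weak[unfolded weakly_ell2_def weakly_contained_def, rule_format, OF UNIV_I T, of \<xi>] by blast
  have eta: "(\<Sum>z\<in>W \<times> W. ell2_inner G (left_regular G (g z) \<eta>) \<eta>) \<le> R ^ n * l2ip ?X \<eta> \<eta>"
    if "\<eta> \<in> ell2 G" for \<eta>
  proof -
    have s: "sq_summable ?X \<eta>" using that by (simp add: ell2_iff)
    have ls: "sq_summable ?X (left_regular G (?p w) \<eta>)" if "w \<in> W" for w
      using reg.sq_summable_translate[OF cl[OF that] s] by (simp add: tr)
    have g: "ell2_inner G (left_regular G (g (w, w')) \<eta>) \<eta>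
        = l2ip ?X (left_regular G (?p w) \<eta>) (left_regular G (?p w') \<eta>)" if "w \<in> W" "w' \<in> W" for w w'
    proof -
      have "left_regular G (g (w, w')) \<eta> = left_regular G (inv ?p w') (left_regular G (?p w) \<eta>)"
        using reg.translate_mult[of "inv ?p w'" "?p w" \<eta>] cl that by (simp add: tr g_def)
      moreover have "l2ip ?X (left_regular G (?p w') \<eta>) (left_regular G (?p w) \<eta>) =
         l2ip ?X \<eta> (left_regular G (inv ?p w') (left_regular G (?p w) \<eta>))"
        using reg.l2ip_translate_adjoint[of "?p w'" \<eta> "left_regular G (?p w) \<eta>"] cl that by (simp add: tr)
      ultimately show ?thesis
        by (simp add: ell2_inner_eq l2ip_commute[of ?X "left_regular G (inv ?p w') (left_regular G (?p w) \<eta>)" \<eta>]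
            l2ip_commute[of ?X "left_regular G (?p w) \<eta>" "left_regular G (?p w') \<eta>"])
    qed
    have "(\<Sum>z\<in>W \<times> W. ell2_inner G (left_regular G (g z) \<eta>) \<eta>)
       = (\<Sum>w\<in>W. \<Sum>w'\<in>W. ell2_inner G (left_regular G (g (w, w')) \<eta>) \<eta>)"
      by (simp add: sum.cartesian_product case_prod_beta)
    also have "\<dots> = (\<Sum>w\<in>W. \<Sum>w'\<in>W. l2ip ?X (left_regular G (?p w) \<eta>) (left_regular G (?p w') \<eta>))"
      by (intro sum.cong refl g)
    also have "\<dots> = l2ip ?X (\<lambda>x. \<Sum>w\<in>W. left_regular G (?p w) \<eta> x) (\<lambda>x. \<Sum>w\<in>W. left_regular G (?p w) \<eta> x)"
      using ls by (simp add: l2ip_sum_left l2ip_sum_right sq_summable_sum)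
    also have "\<dots> \<le> R ^ n * l2ip ?X \<eta> \<eta>"
      by (rule left_regular_words_bound[OF is_group S R gap W that])
    finally show ?thesis .
  qed
  have "(norm (\<Sum>w\<in>W. \<pi> (?p w) \<xi>))\<^sup>2 = (\<Sum>w\<in>W. \<Sum>w'\<in>W. inner (\<pi> (?p w) \<xi>) (\<pi> (?p w') \<xi>))"
    by (simp add: power2_norm_eq_inner inner_sum_left inner_sum_right) (rule sum.swap)
  also have "\<dots> = (\<Sum>w\<in>W. \<Sum>w'\<in>W. inner (\<pi> (g (w, w')) \<xi>) \<xi>)"
    by (intro sum.cong refl) (simp add: g_def orthogonal_rep_inner_swap[OF is_group rep] cl)
  also have "\<dots> = (\<Sum>z\<in>W \<times> W. inner (\<pi> (g z) \<xi>) \<xi>)"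
    by (simp add: sum.cartesian_product case_prod_beta)
  also have "\<dots> \<le> (\<Sum>z\<in>W \<times> W. (\<Sum>\<eta>\<leftarrow>L. ell2_inner G (left_regular G (g z) \<eta>) \<eta>) + \<epsilon>)"
  proof (rule sum_mono)
    fix z assume "z \<in> W \<times> W"
    then have "\<bar>inner (\<pi> (g z) \<xi>) \<xi> - (\<Sum>\<eta>\<leftarrow>L. ell2_inner G (left_regular G (g z) \<eta>) \<eta>)\<bar> < \<epsilon>"
      by (intro approx) auto
    then show "inner (\<pi> (g z) \<xi>) \<xi> \<le> (\<Sum>\<eta>\<leftarrow>L. ell2_inner G (left_regular G (g z) \<eta>) \<eta>) + \<epsilon>" by linarith
  qed
  also have "\<dots> = (\<Sum>\<eta>\<leftarrow>L. \<Sum>z\<in>W \<times> W. ell2_inner G (left_regular G (g z) \<eta>) \<eta>) + ?N * \<epsilon>"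
    by (simp add: sum.distrib sum_list_sum_swap)
  also have "(\<Sum>\<eta>\<leftarrow>L. \<Sum>z\<in>W \<times> W. ell2_inner G (left_regular G (g z) \<eta>) \<eta>)
      \<le> (\<Sum>\<eta>\<leftarrow>L. R ^ n * l2ip ?X \<eta> \<eta>)"
    by (rule sum_list_mono) (use eta L in auto)
  also have "\<dots> = R ^ n * (\<Sum>\<eta>\<leftarrow>L. l2ip ?X \<eta> \<eta>)" by (simp add: sum_list_const_mult)
  also have "(\<Sum>\<eta>\<leftarrow>L. l2ip ?X \<eta> \<eta>) \<le> (norm \<xi>)\<^sup>2 + \<epsilon>"
  proof -
    have "ell2_inner G (left_regular G \<one> \<eta>) \<eta> = l2ip ?X \<eta> \<eta>" if "\<eta> \<in> set L" for \<eta>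
      using reg.translate_one[of \<eta>] that L by (simp add: ell2_inner_eq tr subset_iff ell2_iff)
    then have "(\<Sum>\<eta>\<leftarrow>L. ell2_inner G (left_regular G \<one> \<eta>) \<eta>) = (\<Sum>\<eta>\<leftarrow>L. l2ip ?X \<eta> \<eta>)"
      by (intro arg_cong[where f = sum_list] map_cong) auto
    then show ?thesis
      using approx[of \<one>] by (simp add: orthogonal_rep_one[OF is_group rep] power2_norm_eq_inner)
  qed
  finally have "(norm (\<Sum>w\<in>W. \<pi> (?p w) \<xi>))\<^sup>2 \<le> R ^ n * ((norm \<xi>)\<^sup>2 + \<epsilon>) + ?N * \<epsilon>"
    using R by (simp add: mult_left_mono)
  also have "\<dots> \<le> R ^ n * (norm \<xi>)\<^sup>2 + (R ^ n + ?N + 1) * \<epsilon>" using \<epsilon> by (simp add: algebra_simps)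
  also have "(R ^ n + ?N + 1) * \<epsilon> = e" using den by (simp add: \<epsilon>_def)
  finally show "(norm (\<Sum>w\<in>W. \<pi> (?p w) \<xi>))\<^sup>2 \<le> R ^ n * (norm \<xi>)\<^sup>2 + e" .
qed

section \<open>Expansion\<close>

context twisted_action
begin

lemma finite_support_translate:
  assumes "g \<in> carrier G" "finite {x \<in> X. v x \<noteq> 0}"
  shows "finite {x \<in> X. translate g v x \<noteq> 0}"
proof (rule finite_subset)
  show "{x \<in> X. translate g v x \<noteq> 0} \<subseteq> \<alpha> g ` {x \<in> X. v x \<noteq> 0}"
  proof
    fix x assume x: "x \<in> {x \<in> X. translate g v x \<noteq> 0}"
    then have "v (\<alpha> (inv g) x) \<noteq> 0"
      using linear_0[OF orthogonal_rep_linear[OF rep assms(1)]] by (auto simp: translate_def)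
    then show "x \<in> \<alpha> g ` {x \<in> X. v x \<noteq> 0}"
      using x assms(1) by (intro image_eqI[of _ _ "\<alpha> (inv g) x"]) (auto simp: act_inv act_closed)
  qed
qed (use assms in simp)

lemma finite_support_word_sum:
  assumes "S \<subseteq> carrier G" "finite S" "finite {x \<in> X. v x \<noteq> 0}"
  shows "finite {x \<in> X. word_sum S n v x \<noteq> 0}"
proof (rule finite_subset)
  show "{x \<in> X. word_sum S n v x \<noteq> 0} \<subseteq>
      (\<Union>w\<in>words S n. {x \<in> X. translate (word_prod G w) v x \<noteq> 0})"
    by (auto simp: word_sum_def dest: sum.not_neutral_contains_not_neutral)
  show "finite (\<Union>w\<in>words S n. {x \<in> X. translate (word_prod G w) v x \<noteq> 0})"
    using assms by (auto intro!: finite_support_translate simp: word_prod_words_closed)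
qed

text \<open>A matrix coefficient of \<open>word_sum S n\<close> between two points only involves the sum of
  \<open>\<pi>\<close> over a subset of the words, so it decays like \<open>R ^ n\<close>; log-convexity of the
  norms of the iterates turns this decay into a bound on the operator.\<close>

lemma word_sum_contraction:
  assumes S: "S \<subseteq> carrier G" "finite S" "\<And>s. s \<in> S \<Longrightarrow> inv s \<in> S" and R: "0 < R"
    and bound: "\<And>n W \<xi>. W \<subseteq> words S n \<Longrightarrow>
      (norm (\<Sum>w\<in>W. \<pi> (word_prod G w) \<xi>))\<^sup>2 \<le> R ^ n * (norm \<xi>)\<^sup>2"
    and v: "finite {x \<in> X. v x \<noteq> 0}" "\<And>x. x \<notin> X \<Longrightarrow> v x = 0"
  shows "l2ip X (word_sum S n v) (word_sum S n v) \<le> R ^ n * l2ip X v v"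
proof (rule word_sum_contraction_power[where P = "\<lambda>v. finite {x \<in> X. v x \<noteq> 0}"])
  fix v :: "'x \<Rightarrow> 'h"
  assume fin: "finite {x \<in> X. v x \<noteq> 0}" and v0: "\<And>x. x \<notin> X \<Longrightarrow> v x = 0"
  let ?E = "{x \<in> X. v x \<noteq> 0}"
  show "l2ip X (word_sum S (Suc 0) v) (word_sum S (Suc 0) v) \<le> R * l2ip X v v"
  proof (rule word_sum_growth_imp_contraction[OF S(1,3) sq_summable_finite_support[OF fin] v0 _ R])
    fix n
    have pt: "norm (word_sum S (n + n) v y) \<le> (\<Sum>x\<in>?E. R ^ n * norm (v x))" if y: "y \<in> X" for y
    proof -
      \<comment> \<open>Words are grouped by the point \<open>x\<close> whose value they carry to
        \<open>y\<close>. Each group is a subset of the words, to which \<open>bound\<close>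
        applies; the even length \<open>n + n\<close> allows an exact square root.\<close>
      let ?W = "\<lambda>x. {w \<in> words S (n + n). \<alpha> (inv word_prod G w) y = x}"
      have "word_sum S (n + n) v y
          = (\<Sum>w\<in>words S (n + n). \<pi> (word_prod G w) (v (\<alpha> (inv word_prod G w) y)))"
        using y by (simp add: word_sum_def translate_def)
      also have "\<dots> = (\<Sum>w\<in>words S (n + n). \<Sum>x\<in>?E.
          if \<alpha> (inv word_prod G w) y = x then \<pi> (word_prod G w) (v x) else 0)"
      proof (rule sum.cong)
        fix w assume "w \<in> words S (n + n)"
        then have w: "word_prod G w \<in> carrier G" using S word_prod_words_closed by blast
        show "\<pi> (word_prod G w) (v (\<alpha> (inv word_prod G w) y)) =
          (\<Sum>x\<in>?E. if \<alpha> (inv word_prod G w) y = x then \<pi> (word_prod G w) (v x) else 0)"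
          using fin w y linear_0[OF orthogonal_rep_linear[OF rep w]]
          by (auto simp: sum.delta' act_closed)
      qed simp
      also have "\<dots> = (\<Sum>x\<in>?E. \<Sum>w\<in>words S (n + n).
          if \<alpha> (inv word_prod G w) y = x then \<pi> (word_prod G w) (v x) else 0)"
        by (rule sum.swap)
      also have "\<dots> = (\<Sum>x\<in>?E. \<Sum>w\<in>?W x. \<pi> (word_prod G w) (v x))"
        using S by (simp add: sum.inter_filter)
      also have "norm \<dots> \<le> (\<Sum>x\<in>?E. R ^ n * norm (v x))"
      proof (rule order_trans[OF norm_sum sum_mono])
        fix x
        have "(norm (\<Sum>w\<in>?W x. \<pi> (word_prod G w) (v x)))\<^sup>2 \<le> R ^ (n + n) * (norm (v x))\<^sup>2"
          by (rule bound) auto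
        also have "\<dots> = (R ^ n * norm (v x))\<^sup>2"
          by (simp add: power_mult_distrib power_add power2_eq_square)
        finally show "norm (\<Sum>w\<in>?W x. \<pi> (word_prod G w) (v x)) \<le> R ^ n * norm (v x)"
          by (rule power2_le_imp_le) (use R in simp)
      qed
      finally show ?thesis .
    qed
    have "l2ip X (word_sum S (n + n) v) v = (\<Sum>y\<in>?E. inner (word_sum S (n + n) v y) (v y))"
      by (rule l2ip_finite_support) (use fin in auto)
    also have "\<dots> \<le> (\<Sum>y\<in>?E. (\<Sum>x\<in>?E. R ^ n * norm (v x)) * norm (v y))"
      by (rule sum_mono) (use pt in \<open>auto intro!: order_trans[OF norm_cauchy_schwarz] mult_right_mono\<close>)
    also have "\<dots> = (\<Sum>x\<in>?E. norm (v x))\<^sup>2 * R ^ n"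
      by (simp add: sum_distrib_left[symmetric] sum_distrib_right[symmetric] power2_eq_square ac_simps)
    finally show "l2ip X (word_sum S (n + n) v) v \<le> (\<Sum>x\<in>?E. norm (v x))\<^sup>2 * R ^ n" .
  qed
qed (use S R v finite_support_word_sum in auto)

text \<open>The word sum of \<xi> restricted to \<open>E\<close> is tested against \<xi> restricted
  to the union \<open>F\<close> of the translates of \<open>E\<close>. Each word contributes at
  least \<open>card E / 2\<close>, whereas Cauchy-Schwarz and the contraction bound limit the total.
  Squaring the 1/2 produces the factor 4.\<close>

lemma expansion:
  assumes S: "S \<subseteq> carrier G" "finite S" and R: "0 < R"
    and contr: "\<And>v. finite {x \<in> X. v x \<noteq> 0} \<Longrightarrow> (\<And>x. x \<notin> X \<Longrightarrow> v x = 0) \<Longrightarrow>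
       l2ip X (word_sum S k v) (word_sum S k v) \<le> R ^ k * l2ip X v v"
    and E: "finite E" "E \<subseteq> X" "\<And>x. x \<in> E \<Longrightarrow> norm (\<xi> x) = 1"
    and equi: "\<And>x w. x \<in> E \<Longrightarrow> w \<in> words S k \<Longrightarrow> norm (\<xi> (\<alpha> (word_prod G w) x)) = 1 \<and>
       1 / 2 \<le> inner (\<pi> (word_prod G w) (\<xi> x)) (\<xi> (\<alpha> (word_prod G w) x))"
  shows "(real (card S) ^ 2) ^ k * real (card E)
      \<le> 4 * R ^ k * real (card (\<Union>w\<in>words S k. \<alpha> (word_prod G w) ` E))"
proof (cases "E = {}")
  case False
  let ?p = "word_prod G"
  define F where "F = (\<Union>w\<in>words S k. \<alpha> (?p w) ` E)"
  have cl: "?p w \<in> carrier G" if "w \<in> words S k" for w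
    using that S word_prod_words_closed by blast
  have F: "finite F" "F \<subseteq> X" using S E cl act_closed by (auto simp: F_def)
  define v where "v = (\<lambda>x. if x \<in> E then \<xi> x else 0)"
  define u where "u = (\<lambda>x. if x \<in> F then \<xi> x else 0)"
  have v0: "v x = 0" if "x \<notin> X" for x using that E by (auto simp: v_def)
  have finv: "finite {x \<in> X. v x \<noteq> 0}" by (rule finite_subset[OF _ E(1)]) (auto simp: v_def)
  have finu: "finite {x \<in> X. u x \<noteq> 0}" by (rule finite_subset[OF _ F(1)]) (auto simp: u_def)
  note sv = sq_summable_finite_support[OF finv] and su = sq_summable_finite_support[OF finu]
  have vv: "l2ip X v v = real (card E)"
    using l2ip_finite_support[of E X v v] E by (simp add: v_def power2_norm_eq_inner[symmetric])
  have norm_F: "norm (\<xi> y) = 1" if "y \<in> F" for y using that equi by (auto simp: F_def)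
  have uu: "l2ip X u u = real (card F)"
    using l2ip_finite_support[of F X u u] F norm_F by (simp add: u_def power2_norm_eq_inner[symmetric])
  have le: "real (card E) / 2 \<le> l2ip X (translate (?p w) v) u" if w: "w \<in> words S k" for w
  proof -
    have sub: "\<alpha> (?p w) ` E \<subseteq> F" using w by (auto simp: F_def)
    have inj: "inj_on (\<alpha> (?p w)) E"
      using bij_act[OF cl[OF w]] E(2) by (meson bij_betw_def inj_on_subset)
    have "real (card E) / 2 = (\<Sum>x\<in>E. 1 / 2)" by simp
    also have "\<dots> \<le> (\<Sum>x\<in>E. inner (translate (?p w) v (\<alpha> (?p w) x)) (u (\<alpha> (?p w) x)))"
    proof (rule sum_mono)
      fix x assume x: "x \<in> E"
      then have "\<alpha> (?p w) x \<in> F" using sub by auto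
      moreover have "translate (?p w) v (\<alpha> (?p w) x) = \<pi> (?p w) (\<xi> x)"
        using x E cl[OF w] by (auto simp: translate_def act_closed act_inv v_def subset_iff)
      ultimately show "1 / 2 \<le> inner (translate (?p w) v (\<alpha> (?p w) x)) (u (\<alpha> (?p w) x))"
        using equi[OF x w] by (simp add: u_def)
    qed
    also have "\<dots> = (\<Sum>y\<in>\<alpha> (?p w) ` E. inner (translate (?p w) v y) (u y))"
      by (simp add: sum.reindex[OF inj])
    also have "\<dots> = l2ip X (translate (?p w) v) u"
      unfolding l2ip_commute[of X "translate (?p w) v"]
    proof (subst l2ip_finite_support[of "\<alpha> (?p w) ` E"])
      fix y assume y: "y \<in> X - \<alpha> (?p w) ` E"
      then have "\<alpha> (inv ?p w) y \<notin> E" using act_inv(1)[OF cl[OF w], of y] by force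
      then show "translate (?p w) v y = 0"
        using linear_0[OF orthogonal_rep_linear[OF rep cl[OF w]]] by (auto simp: translate_def v_def)
    qed (use E F sub in \<open>auto simp: inner_commute\<close>)
    finally show ?thesis .
  qed
  let ?c = "real (card S)"
  have "?c ^ k * (real (card E) / 2) = (\<Sum>w\<in>words S k. real (card E) / 2)"
    using S by (simp add: card_words)
  also have "\<dots> \<le> (\<Sum>w\<in>words S k. l2ip X (translate (?p w) v) u)" by (rule sum_mono) (rule le)
  also have "\<dots> = l2ip X (word_sum S k v) u"
    unfolding word_sum_def
    by (rule l2ip_sum_left[symmetric]) (use sv su sq_summable_translate cl in auto)
  finally have "(?c ^ k * (real (card E) / 2))\<^sup>2 \<le> (l2ip X (word_sum S k v) u)\<^sup>2"
    by (intro power_mono) auto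
  also have "\<dots> \<le> l2ip X (word_sum S k v) (word_sum S k v) * l2ip X u u"
    by (rule l2ip_Cauchy_Schwarz[OF sq_summable_word_sum[OF S(1) sv] su])
  also have "\<dots> \<le> (R ^ k * real (card E)) * real (card F)"
    unfolding uu using contr[OF finv v0] by (intro mult_right_mono) (auto simp: vv)
  finally have "real (card E) * ((?c\<^sup>2) ^ k * real (card E)) \<le> real (card E) * (4 * R ^ k * real (card F))"
    by (simp add: power_mult_distrib power2_eq_square field_simps)
  moreover have "real (card E) > 0" using False E by (simp add: card_gt_0_iff)
  ultimately show ?thesis unfolding F_def by (simp only: mult_le_cancel_left_pos)
qed simp

end

section \<open>Matchings and finitely additive measures\<close>

text \<open>Rado's argument: in a family that satisfies the Hall condition and is minimal with this
  property, every set is a singleton, by submodularity of the cardinality of unions.\<close>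

lemma hall_marriage:
  fixes A :: "'i \<Rightarrow> 'b set"
  assumes fin: "\<And>i. i \<in> I \<Longrightarrow> finite (A i)"
    and hall: "\<And>J. finite J \<Longrightarrow> J \<subseteq> I \<Longrightarrow> card J \<le> card (\<Union>j\<in>J. A j)"
  obtains f where "inj_on f I" "\<And>i. i \<in> I \<Longrightarrow> f i \<in> A i"
proof -
  define Hall where "Hall R \<longleftrightarrow> (\<forall>J. finite J \<and> J \<subseteq> I \<longrightarrow> card J \<le> card (R `` J))" for R :: "('i \<times> 'b) set"
  \<comment> \<open>The members are sets of pairs that may be deleted without violating the Hall
    condition. A maximal one, from Zorn's lemma, leaves a minimal relation.\<close>
  define \<N> where "\<N> = {N. N \<subseteq> Sigma I A \<and> Hall (Sigma I A - N)}"
  have "Hall (Sigma I A)"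
  proof -
    have "Sigma I A `` J = (\<Union>j\<in>J. A j)" if "J \<subseteq> I" for J using that by auto
    then show ?thesis unfolding Hall_def using hall by simp
  qed
  then have "\<N> \<noteq> {}" by (auto simp: \<N>_def)
  moreover have "\<Union>C \<in> \<N>" if C: "C \<noteq> {}" "subset.chain \<N> C" for C
  proof -
    have sub: "N \<subseteq> Sigma I A \<and> Hall (Sigma I A - N)" if "N \<in> C" for N
      using C that unfolding subset.chain_def \<N>_def by auto
    have "Hall (Sigma I A - \<Union>C)"
      unfolding Hall_def
    proof (intro allI impI)
      fix J assume J: "finite J \<and> J \<subseteq> I"
      \<comment> \<open>Only finitely many pairs lie over a finite \<open>J\<close>, so a single
        member of the chain already deletes all of those that the union deletes.\<close>
      have "finite (Sigma J A \<inter> \<Union>C)" using J fin by (intro finite_Int disjI1 finite_SigmaI) auto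
      then obtain N where N: "N \<in> C" "Sigma J A \<inter> \<Union>C \<subseteq> N"
        using finite_subset_Union_chain[of "Sigma J A \<inter> \<Union>C" C \<N>] C by auto
      have "(Sigma I A - \<Union>C) `` J = (Sigma I A - N) `` J" using N by auto
      then show "card J \<le> card ((Sigma I A - \<Union>C) `` J)"
        using sub[OF N(1)] J by (simp add: Hall_def)
    qed
    then show ?thesis using sub by (auto simp: \<N>_def)
  qed
  ultimately obtain N where N: "N \<in> \<N>" and max: "\<And>M. M \<in> \<N> \<Longrightarrow> N \<subseteq> M \<Longrightarrow> M = N"
    using subset_Zorn_nonempty[of \<N>] by metis
  define R where "R = Sigma I A - N"
  have R: "R \<subseteq> Sigma I A" and HR: "\<And>J. finite J \<Longrightarrow> J \<subseteq> I \<Longrightarrow> card J \<le> card (R `` J)"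
    using N by (auto simp: R_def \<N>_def Hall_def)
  have finR: "finite (R `` J)" if "finite J" "J \<subseteq> I" for J
  proof (rule finite_subset)
    show "R `` J \<subseteq> (\<Union>j\<in>J. A j)" using R by auto
  qed (use fin that in auto)
  have min: "\<exists>J. finite J \<and> J \<subseteq> I \<and> x \<in> J \<and> card ((R - {(x, a)}) `` J) \<le> card (J - {x})"
    if "(x, a) \<in> R" for x a
  proof -
    have "insert (x, a) N \<notin> \<N>"
      using max[of "insert (x, a) N"] that by (auto simp: R_def)
    moreover have "Sigma I A - insert (x, a) N = R - {(x, a)}" by (auto simp: R_def)
    ultimately have "\<not> Hall (R - {(x, a)})" using N that R by (auto simp: \<N>_def)
    then obtain J where J: "finite J" "J \<subseteq> I" "card ((R - {(x, a)}) `` J) < card J"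
      unfolding Hall_def by (auto simp: not_le)
    have x: "x \<in> J"
    proof (rule ccontr)
      assume "x \<notin> J"
      then have "(R - {(x, a)}) `` J = R `` J" by auto
      then show False using HR[OF J(1,2)] J(3) by simp
    qed
    then show ?thesis using J by (intro exI[of _ J]) (auto simp: card_Diff_singleton)
  qed
  have unique: "a = b" if ab: "(x, a) \<in> R" "(x, b) \<in> R" for x a b
  proof (rule ccontr)
    assume "a \<noteq> b"
    obtain J K where J: "finite J" "J \<subseteq> I" "x \<in> J" "card ((R - {(x, a)}) `` J) \<le> card (J - {x})"
      and K: "finite K" "K \<subseteq> I" "x \<in> K" "card ((R - {(x, b)}) `` K) \<le> card (K - {x})"
      using min[OF ab(1)] min[OF ab(2)] by blast
    let ?P = "(R - {(x, a)}) `` J" and ?Q = "(R - {(x, b)}) `` K"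
    let ?J = "J - {x}" and ?K = "K - {x}"
    have finPQ: "finite ?P" "finite ?Q"
      using finR[OF J(1,2)] finR[OF K(1,2)] by (auto elim: finite_subset[rotated])
    \<comment> \<open>Different pairs at \<open>x\<close> are deleted in \<open>?P\<close> and
      \<open>?Q\<close>, so their union contains every partner of \<open>x\<close>. Counting the
      union and the intersection then exceeds \<open>card ?P + card ?Q\<close> by one.\<close>
    have "card (insert x (?J \<union> ?K)) \<le> card (R `` insert x (?J \<union> ?K))"
      by (rule HR) (use J K in auto)
    also have "\<dots> \<le> card (?P \<union> ?Q)"
      by (rule card_mono) (use finPQ \<open>a \<noteq> b\<close> J K in auto)
    finally have u: "card (?J \<union> ?K) + 1 \<le> card (?P \<union> ?Q)" using J K by simp
    have "card (?J \<inter> ?K) \<le> card (R `` (?J \<inter> ?K))"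
      by (rule HR) (use J K in auto)
    also have "\<dots> \<le> card (?P \<inter> ?Q)"
      by (rule card_mono) (use finPQ in auto)
    finally have i: "card (?J \<inter> ?K) \<le> card (?P \<inter> ?Q)" .
    have "card ?J + card ?K = card (?J \<union> ?K) + card (?J \<inter> ?K)" using J K by (intro card_Un_Int) auto
    moreover have "card ?P + card ?Q = card (?P \<union> ?Q) + card (?P \<inter> ?Q)" using finPQ by (rule card_Un_Int)
    ultimately show False using u i J(4) K(4) by linarith
  qed
  have ex: "\<exists>a. (i, a) \<in> R" if "i \<in> I" for i
  proof (rule ccontr)
    assume "\<nexists>a. (i, a) \<in> R"
    then have "R `` {i} = {}" by auto
    then show False using HR[of "{i}"] that by simp
  qed
  define f where "f i = (SOME a. (i, a) \<in> R)" for i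
  have f: "(i, f i) \<in> R" if "i \<in> I" for i unfolding f_def using ex[OF that] by (rule someI_ex)
  show thesis
  proof (rule that[of f])
    show "f i \<in> A i" if "i \<in> I" for i using f[OF that] R by auto
    show "inj_on f I"
    proof (rule inj_onI, rule ccontr)
      fix i j assume ij: "i \<in> I" "j \<in> I" "f i = f j" "i \<noteq> j"
      have "R `` {i, j} \<subseteq> {f i}" using unique f ij by auto
      then have "card (R `` {i, j}) \<le> 1" using card_mono[of "{f i}"] by force
      moreover have "card {i, j} \<le> card (R `` {i, j})" by (rule HR) (use ij in auto)
      ultimately show False using ij by simp
    qed
  qed
qed

section \<open>Expansion against finitely additive measures\<close>

lemma fin_additive_prob_UN:
  assumes m: "fin_additive_prob X m" and "finite I"
    and "\<And>i. i \<in> I \<Longrightarrow> A i \<subseteq> X" "disjoint_family_on A I"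
  shows "m (\<Union>i\<in>I. A i) = (\<Sum>i\<in>I. m (A i))"
  using assms(2-)
proof (induction I rule: finite_induct)
  case empty
  have "m ({} \<union> {}) = m {} + m {}"
    using m unfolding fin_additive_prob_def by (intro additiveD[of "Pow X"]) auto
  then show ?case by simp
next
  case (insert i I)
  have "m (A i \<union> (\<Union>i\<in>I. A i)) = m (A i) + m (\<Union>i\<in>I. A i)"
    using m insert.prems insert.hyps unfolding fin_additive_prob_def
    by (intro additiveD[of "Pow X"]) (auto simp: disjoint_family_on_def)
  moreover have "disjoint_family_on A I"
    using insert.prems by (auto simp: disjoint_family_on_def)
  ultimately show ?case using insert by simp
qed

lemma fin_additive_prob_mono:
  assumes m: "fin_additive_prob X m" and "A \<subseteq> B" "B \<subseteq> X"
  shows "m A \<le> m B"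
proof -
  have "m (A \<union> (B - A)) = m A + m (B - A)"
    using assms unfolding fin_additive_prob_def by (intro additiveD[of "Pow X"]) auto
  moreover have "A \<union> (B - A) = B" using assms by blast
  moreover have "0 \<le> m (B - A)"
  proof -
    have "B - A \<subseteq> X" using assms by blast
    then show ?thesis using m unfolding fin_additive_prob_def by blast
  qed
  ultimately show ?thesis by (metis le_add_same_cancel1)
qed

text \<open>Expansion is the Hall condition for \<open>n\<close> copies of \<open>Y\<close>, each
  point being matched with one of its images under \<open>P\<close>. The matching embeds the copies
  disjointly and piecewise by elements of \<open>P\<close>, so each copy has the measure of
  \<open>Y\<close> and all fit into \<open>X\<close>.\<close>

lemma expanding_measure_le:
  assumes m: "fin_additive_prob X m"
    and inv: "\<And>g A. g \<in> P \<Longrightarrow> A \<subseteq> X \<Longrightarrow> m (\<alpha> g ` A) = m A"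
    and P: "finite P" "\<And>g x. g \<in> P \<Longrightarrow> x \<in> X \<Longrightarrow> \<alpha> g x \<in> X"
    and Y: "Y \<subseteq> X" "\<And>E. finite E \<Longrightarrow> E \<subseteq> Y \<Longrightarrow> n * card E \<le> card (\<Union>g\<in>P. \<alpha> g ` E)"
  shows "real n * m Y \<le> 1"
proof -
  let ?I = "{..<n} \<times> Y" and ?A = "\<lambda>(i::nat, x). (\<lambda>g. \<alpha> g x) ` P"
  obtain f where inj: "inj_on f ?I" and f: "\<And>z. z \<in> ?I \<Longrightarrow> f z \<in> ?A z"
  proof (rule hall_marriage[of ?I ?A])
    fix J assume J: "finite J" "J \<subseteq> ?I"
    have "z \<in> {..<n} \<times> snd ` J" if "z \<in> J" for z
    proof -
      have "fst z \<in> {..<n}" using J that by auto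
      moreover have "snd z \<in> snd ` J" using that by (rule imageI)
      ultimately show ?thesis by (metis mem_Times_iff)
    qed
    then have "J \<subseteq> {..<n} \<times> snd ` J" by blast
    then have "card J \<le> card ({..<n} \<times> snd ` J)" using J by (intro card_mono) auto
    also have "\<dots> = n * card (snd ` J)" by (simp add: card_cartesian_product)
    also have "\<dots> \<le> card (\<Union>g\<in>P. \<alpha> g ` snd ` J)" using J by (intro Y) auto
    also have "(\<Union>g\<in>P. \<alpha> g ` snd ` J) = (\<Union>j\<in>J. ?A j)"
      by (auto simp: case_prod_unfold image_image)
    finally show "card J \<le> card (\<Union>j\<in>J. ?A j)" .
  qed (use P in auto)
  \<comment> \<open>The element of \<open>P\<close> realizing the match; its values cut each copy of
    \<open>Y\<close> into finitely many pieces.\<close>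
  define c where "c i x = (SOME g. g \<in> P \<and> f (i, x) = \<alpha> g x)" for i x
  have c: "c i x \<in> P \<and> f (i, x) = \<alpha> (c i x) x" if "i < n" "x \<in> Y" for i x
  proof -
    have "\<exists>g. g \<in> P \<and> f (i, x) = \<alpha> g x" using f[of "(i, x)"] that by auto
    from someI_ex[OF this] show ?thesis unfolding c_def .
  qed
  have image: "m ((\<lambda>x. f (i, x)) ` Y) = m Y" if i: "i < n" for i
  proof -
    let ?Y = "\<lambda>g. {x \<in> Y. c i x = g}"
    have "(\<lambda>x. f (i, x)) ` Y = (\<Union>g\<in>P. \<alpha> g ` ?Y g)" 
    proof (intro equalityI subsetI)
      fix y assume "y \<in> (\<lambda>x. f (i, x)) ` Y"
      then obtain x where x: "x \<in> Y" "y = f (i, x)" by blast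
      then have "y \<in> \<alpha> (c i x) ` ?Y (c i x)" using c[OF i x(1)] by simp
      then show "y \<in> (\<Union>g\<in>P. \<alpha> g ` ?Y g)" using c[OF i x(1)] by blast
    next
      fix y assume "y \<in> (\<Union>g\<in>P. \<alpha> g ` ?Y g)"
      then obtain x where x: "x \<in> Y" "y = \<alpha> (c i x) x" by blast
      then have "y = f (i, x)" using c[OF i x(1)] by simp
      then show "y \<in> (\<lambda>x. f (i, x)) ` Y" using x(1) by (rule image_eqI)
    qed
    also have "m \<dots> = (\<Sum>g\<in>P. m (\<alpha> g ` ?Y g))"
    proof (rule fin_additive_prob_UN[OF m P(1)])
      show "\<alpha> g ` ?Y g \<subseteq> X" if "g \<in> P" for g using P that Y by auto
      \<comment> \<open>Images of different pieces are disjoint because the matching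
        \<open>f\<close> is injective.\<close>
      show "disjoint_family_on (\<lambda>g. \<alpha> g ` ?Y g) P"
        unfolding disjoint_family_on_def
      proof (intro ballI impI)
        fix g h assume "g \<in> P" "h \<in> P" and gh: "g \<noteq> h"
        show "\<alpha> g ` ?Y g \<inter> \<alpha> h ` ?Y h = {}"
        proof (rule ccontr)
          assume "\<alpha> g ` ?Y g \<inter> \<alpha> h ` ?Y h \<noteq> {}"
          then obtain x y where xy: "x \<in> Y" "c i x = g" "y \<in> Y" "c i y = h" "\<alpha> g x = \<alpha> h y" by blast
          then have "f (i, x) = f (i, y)" using c[OF i xy(1)] c[OF i xy(3)] by simp
          then have "(i, x) = (i, y)" by (rule inj_onD[OF inj]) (use xy i in auto)
          then show False using xy(2,4) gh by simp
        qed
      qed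
    qed
    also have "\<dots> = (\<Sum>g\<in>P. m (?Y g))"
      by (intro sum.cong refl inv) (use Y in auto)
    also have "\<dots> = m (\<Union>g\<in>P. ?Y g)"
      by (rule fin_additive_prob_UN[OF m P(1), symmetric]) (use Y in \<open>auto simp: disjoint_family_on_def\<close>)
    also have "(\<Union>g\<in>P. ?Y g) = Y" using c[OF i] by auto
    finally show ?thesis .
  qed
  have fX: "f (i, x) \<in> X" if "i < n" "x \<in> Y" for i x using c[OF that] P Y that by auto
  have "real n * m Y = (\<Sum>i<n. m ((\<lambda>x. f (i, x)) ` Y))" using image by simp
  also have "\<dots> = m (\<Union>i<n. (\<lambda>x. f (i, x)) ` Y)"
  proof (rule fin_additive_prob_UN[OF m, symmetric])
    show "disjoint_family_on (\<lambda>i. (\<lambda>x. f (i, x)) ` Y) {..<n}"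
      unfolding disjoint_family_on_def
    proof (intro ballI impI equals0I)
      fix i j y assume ij: "i \<in> {..<n}" "j \<in> {..<n}" "i \<noteq> j"
        and "y \<in> (\<lambda>x. f (i, x)) ` Y \<inter> (\<lambda>x. f (j, x)) ` Y"
      then obtain x z where xz: "x \<in> Y" "z \<in> Y" "f (i, x) = f (j, z)" by auto
      have "(i, x) = (j, z)" by (rule inj_onD[OF inj xz(3)]) (use ij xz in auto)
      then show False using ij by simp
    qed
  qed (use fX in auto)
  also have "\<dots> \<le> m X" by (rule fin_additive_prob_mono[OF m]) (use fX in auto)
  also have "\<dots> = 1" using m by (simp add: fin_additive_prob_def)
  finally show ?thesis .
qed

section \<open>Quasi-cocycles and invariant means\<close>

lemma twisted_action_conj:
  fixes G (structure)
  assumes "group G" "orthogonal_rep G \<pi>"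
  shows "twisted_action G (carrier G) (\<lambda>g x. g \<otimes> x \<otimes> inv g) \<pi>"
proof -
  interpret group G by (rule assms)
  show ?thesis
    by unfold_locales (use assms in \<open>simp_all add: m_assoc inv_mult_group\<close>)
qed

text \<open>The quasi-cocycle inequality is used once for \<open>g\<close> and
  \<open>x \<otimes> inv g\<close>, once for \<open>x\<close> and \<open>inv g\<close>, each at cost
  \<open>C\<close>. Anti-symmetry rewrites the value at \<open>inv g\<close> through
  \<open>q g\<close>.\<close>

lemma quasi_cocycle_conj:
  fixes G (structure) and \<pi> :: "_ \<Rightarrow> 'h \<Rightarrow> 'h::{real_inner,complete_space}"
  assumes "group G" and rep: "orthogonal_rep G \<pi>"
    and C: "\<And>g h. g \<in> carrier G \<Longrightarrow> h \<in> carrier G \<Longrightarrow> norm (q (g \<otimes> h) - q g - \<pi> g (q h)) \<le> C"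
    and anti: "antisymmetric G \<pi> q"
    and g: "g \<in> carrier G" and x: "x \<in> carrier G"
  shows "norm (q (g \<otimes> x \<otimes> inv g) - \<pi> g (q x) - (q g - \<pi> (g \<otimes> x \<otimes> inv g) (q g))) \<le> 2 * C"
proof -
  interpret group G by (rule assms)
  let ?y = "g \<otimes> x \<otimes> inv g"
  have y: "?y = g \<otimes> (x \<otimes> inv g)" using g x by (simp add: m_assoc)
  note lin = orthogonal_rep_linear[OF rep g] orthogonal_rep_linear[OF rep x]
  have qi: "q (inv g) = - \<pi> (inv g) (q g)"
    using anti[unfolded antisymmetric_def, rule_format, of "inv g"] g by simp
  have "\<pi> g (\<pi> x (q (inv g))) = - \<pi> ?y (q g)"
    unfolding y qi using g x
    by (simp add: linear_neg[OF lin(1)] linear_neg[OF lin(2)] orthogonal_rep_mult[OF rep])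
  then have 1: "\<pi> g (q (x \<otimes> inv g) - q x - \<pi> x (q (inv g)))
      = \<pi> g (q (x \<otimes> inv g)) - \<pi> g (q x) + \<pi> ?y (q g)"
    by (simp add: linear_diff[OF lin(1)])
  have "norm (\<pi> g (q (x \<otimes> inv g) - q x - \<pi> x (q (inv g)))) \<le> C"
    using C[of x "inv g"] g x by (simp add: orthogonal_rep_norm[OF rep])
  moreover have "norm (q ?y - q g - \<pi> g (q (x \<otimes> inv g))) \<le> C"
    unfolding y using C[of g "x \<otimes> inv g"] g x by simp
  moreover have eq: "q ?y - \<pi> g (q x) - (q g - \<pi> ?y (q g))
    = (q ?y - q g - \<pi> g (q (x \<otimes> inv g))) + (\<pi> g (q (x \<otimes> inv g)) - \<pi> g (q x) + \<pi> ?y (q g))"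
    by simp
  ultimately show ?thesis
    unfolding eq
    using norm_triangle_ineq[of "q ?y - q g - \<pi> g (q (x \<otimes> inv g))"
        "\<pi> g (q (x \<otimes> inv g)) - \<pi> g (q x) + \<pi> ?y (q g)"]
    unfolding 1 by linarith
qed

text \<open>By polarization it suffices that the sum of the squared norms minus
  \<open>norm a * norm b\<close> is at least the square of \<open>K\<close>; completing the square
  gives at least three quarters of the squared norm of \<open>a\<close>. The summand 1 excludes zero
  vectors when \<open>K = 0\<close>.\<close>

lemma normalized_inner_ge_half:
  fixes a b :: "'h::real_inner"
  assumes K: "0 \<le> K" "norm (b - a) \<le> K" "2 * K + 1 \<le> norm a"
  shows "b \<noteq> 0" "1 / 2 \<le> inner (a /\<^sub>R norm a) (b /\<^sub>R norm b)"
proof -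
  have "norm a \<le> norm b + norm (b - a)" by (metis add.commute norm_minus_commute norm_triangle_sub)
  then have b: "norm b > 0" using K by linarith
  then show "b \<noteq> 0" by simp
  have a: "norm a > 0" using K by linarith
  have "(norm (b - a))\<^sup>2 = (norm a)\<^sup>2 + (norm b)\<^sup>2 - 2 * inner a b"
    by (simp add: power2_norm_eq_inner inner_diff_left inner_diff_right inner_commute)
  moreover have "(norm (b - a))\<^sup>2 \<le> K\<^sup>2" using K by (intro power_mono) auto
  moreover have "(2 * K)\<^sup>2 \<le> (norm a)\<^sup>2" using K by (intro power_mono) auto
  then have "4 * K\<^sup>2 \<le> (norm a)\<^sup>2" by (simp add: power_mult_distrib)
  moreover have "(norm a)\<^sup>2 + (norm b)\<^sup>2 - norm a * norm b = 3 / 4 * (norm a)\<^sup>2 + (norm b - norm a / 2)\<^sup>2"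
    by (simp add: power2_eq_square field_simps)
  moreover have "0 \<le> (norm b - norm a / 2)\<^sup>2" "0 \<le> K\<^sup>2" by simp_all
  ultimately have "norm a * norm b \<le> 2 * inner a b" by linarith
  then have "1 / 2 \<le> inner a b / (norm a * norm b)"
    using mult_pos_pos[OF a b] by (simp add: pos_le_divide_eq)
  also have "\<dots> = inner (a /\<^sub>R norm a) (b /\<^sub>R norm b)"
    by (simp add: divide_inverse mult.assoc mult.commute)
  finally show "1 / 2 \<le> inner (a /\<^sub>R norm a) (b /\<^sub>R norm b)" .
qed

lemma exists_expansion_power:
  fixes R c :: real
  assumes "0 < R" "R < c" "0 < N"
  obtains k where "N * R ^ k \<le> c ^ k"
proof -
  obtain k where "N < (c / R) ^ k"
    using real_arch_pow[of "c / R" N] assms by auto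
  then have "N * R ^ k \<le> c ^ k" using assms by (simp add: power_divide field_simps)
  then show thesis by (rule that)
qed

text \<open>Where \<open>q\<close> is large compared with its failure of equivariance, its
  normalization is almost equivariant, and \<open>expansion\<close> turns the norm gap into growth
  of finite sets by the factor 3.\<close>

lemma mean_expansion:
  fixes G :: "('g, 'm) monoid_scheme" (structure) and \<pi> :: "'g \<Rightarrow> 'h \<Rightarrow> 'h::{real_inner,complete_space}"
  assumes "group G" and na: "\<not> amenable G" and rep: "orthogonal_rep G \<pi>" and weak: "weakly_ell2 G \<pi>"
    and q: "\<And>g x. g \<in> carrier G \<Longrightarrow> x \<in> carrier G \<Longrightarrow>
      norm (q (g \<otimes> x \<otimes> inv g) - \<pi> g (q x)) \<le> K g"
    and m: "fin_additive_prob (carrier G) m"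
      "\<And>g A. g \<in> carrier G \<Longrightarrow> A \<subseteq> carrier G \<Longrightarrow> m ((\<lambda>x. g \<otimes> x \<otimes> inv g) ` A) = m A"
  obtains r where "3 * m {x \<in> carrier G. r < norm (q x)} \<le> 1"
proof -
  interpret group G by (rule assms)
  let ?X = "carrier G" and ?p = "word_prod G"
  interpret conj: twisted_action G ?X "\<lambda>g x. g \<otimes> x \<otimes> inv g" \<pi>
    by (rule twisted_action_conj[OF is_group rep])
  obtain S R where S: "finite S" "S \<subseteq> ?X" "\<one> \<in> S" "\<And>s. s \<in> S \<Longrightarrow> inv s \<in> S"
    and R: "0 < R" "R < real (card S) ^ 2"
    and gap: "\<And>f. f \<in> ell2 G \<Longrightarrow> l2ip ?X (\<lambda>x. \<Sum>s\<in>S. left_regular G s f x)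
        (\<lambda>x. \<Sum>s\<in>S. left_regular G s f x) \<le> R * l2ip ?X f f"
    using nonamenable_norm_gap[OF is_group na] by blast
  \<comment> \<open>12 is the desired growth factor 3 times the factor 4 lost in
    \<open>expansion\<close>.\<close>
  obtain k where k: "12 * R ^ k \<le> (real (card S) ^ 2) ^ k"
    using exists_expansion_power[OF R, of 12] by auto
  define P where "P = ?p ` words S k"
  have P: "finite P" "P \<subseteq> ?X" using S word_prod_words_closed by (auto simp: P_def)
  have K0: "0 \<le> K g" if "g \<in> ?X" for g using order_trans[OF norm_ge_zero q[OF that one_closed]] .
  define L where "L = (\<Sum>g\<in>P. K g)"
  have L: "K g \<le> L" if "g \<in> P" for g
    unfolding L_def by (rule member_le_sum) (use that P K0 in auto)
  have L0: "0 \<le> L" unfolding L_def by (rule sum_nonneg) (use P K0 in auto)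
  \<comment> \<open>\<open>L\<close> bounds the equivariance error for all elements of
    \<open>P\<close> at once, and the threshold is the one of
    \<open>normalized_inner_ge_half\<close>.\<close>
  let ?Y = "{x \<in> ?X. 2 * L + 1 < norm (q x)}"
  define \<xi> where "\<xi> x = q x /\<^sub>R norm (q x)" for x
  have norm_\<xi>: "norm (\<xi> x) = 1" if "q x \<noteq> 0" for x using that by (simp add: \<xi>_def)
  have equi: "norm (\<xi> (g \<otimes> x \<otimes> inv g)) = 1 \<and> 1 / 2 \<le> inner (\<pi> g (\<xi> x)) (\<xi> (g \<otimes> x \<otimes> inv g))"
    if g: "g \<in> P" and x: "x \<in> ?Y" for g x
  proof -
    have gX: "g \<in> ?X" using g P by auto
    have n: "norm (\<pi> g (q x)) = norm (q x)" by (rule orthogonal_rep_norm[OF rep gX])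
    have 1: "norm (q (g \<otimes> x \<otimes> inv g) - \<pi> g (q x)) \<le> L"
      using q[OF gX, of x] L[OF g] x by auto
    have 2: "2 * L + 1 \<le> norm (\<pi> g (q x))" using x n by simp
    have "\<pi> g (\<xi> x) = \<pi> g (q x) /\<^sub>R norm (\<pi> g (q x))"
      unfolding n \<xi>_def by (rule linear_cmul[OF orthogonal_rep_linear[OF rep gX]])
    then show ?thesis
      using normalized_inner_ge_half[OF L0 1 2] norm_\<xi> by (simp add: \<xi>_def)
  qed
  have "3 * m ?Y \<le> 1"
  proof -
    have "real 3 * m ?Y \<le> 1"
    proof (rule expanding_measure_le[OF m(1), where P = P and \<alpha> = "\<lambda>g x. g \<otimes> x \<otimes> inv g"])
      fix E assume E: "finite E" "E \<subseteq> ?Y"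
      let ?F = "\<Union>w\<in>words S k. (\<lambda>x. ?p w \<otimes> x \<otimes> inv ?p w) ` E"
      have "(real (card S) ^ 2) ^ k * real (card E) \<le> 4 * R ^ k * real (card ?F)"
      proof (rule conj.expansion[OF S(2,1) R(1), where \<xi> = \<xi>])
        fix v :: "'g \<Rightarrow> 'h"
        assume v: "finite {x \<in> ?X. v x \<noteq> 0}" "\<And>x. x \<notin> ?X \<Longrightarrow> v x = 0"
        show "l2ip ?X (conj.word_sum S k v) (conj.word_sum S k v) \<le> R ^ k * l2ip ?X v v"
        proof (rule conj.word_sum_contraction[OF S(2,1,4) R(1) _ v])
          fix n W \<zeta> assume "W \<subseteq> words S n"
          then show "(norm (\<Sum>w\<in>W. \<pi> (?p w) \<zeta>))\<^sup>2 \<le> R ^ n * (norm \<zeta>)\<^sup>2"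
            using weakly_ell2_words_bound[OF is_group S(2,1) less_imp_le[OF R(1)] gap rep weak] by blast
        qed
      next
        fix x w assume "x \<in> E" "w \<in> words S k"
        then show "norm (\<xi> (?p w \<otimes> x \<otimes> inv ?p w)) = 1 \<and>
            1 / 2 \<le> inner (\<pi> (?p w) (\<xi> x)) (\<xi> (?p w \<otimes> x \<otimes> inv ?p w))"
          using E by (intro equi) (auto simp: P_def)
      next
        fix x assume "x \<in> E"
        then have "q x \<noteq> 0" using E L0 by auto
        then show "norm (\<xi> x) = 1" by (rule norm_\<xi>)
      qed (use E in auto)
      moreover have "12 * R ^ k * real (card E) \<le> (real (card S) ^ 2) ^ k * real (card E)"
        using k by (intro mult_right_mono) auto
      ultimately have "(4 * R ^ k) * (3 * real (card E)) \<le> (4 * R ^ k) * real (card ?F)" by linarith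
      then have "3 * real (card E) \<le> real (card ?F)"
        by (rule mult_left_le_imp_le) (use R(1) in simp)
      moreover have "?F = (\<Union>g\<in>P. (\<lambda>x. g \<otimes> x \<otimes> inv g) ` E)" by (auto simp: P_def)
      ultimately show "3 * card E \<le> card (\<Union>g\<in>P. (\<lambda>x. g \<otimes> x \<otimes> inv g) ` E)" by simp
    qed (use P m in auto)
    then show ?thesis by simp
  qed
  then show thesis by (rule that)
qed

text \<open>\<open>mean_expansion\<close> leaves at least 2/3 of the mass on a set \<open>B\<close>
  where \<open>q\<close> is bounded. Hence \<open>B\<close> meets each of its conjugates in an
  infinite set, and mixing along this set bounds \<open>q g\<close> independently of
  \<open>g\<close>.\<close>

lemma no_diffuse_conj_invariant_mean:
  fixes G :: "('g, 'm) monoid_scheme" (structure) and \<pi> :: "'g \<Rightarrow> 'h \<Rightarrow> 'h::{real_inner,complete_space}"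
  assumes "group G" and na: "\<not> amenable G" and rep: "orthogonal_rep G \<pi>" and weak: "weakly_ell2 G \<pi>"
    and mix: "mixing G \<pi>" and q: "q \<in> QH1_as G \<pi>"
    and m: "fin_additive_prob (carrier G) m"
      "\<And>g A. g \<in> carrier G \<Longrightarrow> A \<subseteq> carrier G \<Longrightarrow> m ((\<lambda>x. g \<otimes> x \<otimes> inv g) ` A) = m A"
    and diffuse: "\<And>A. finite A \<Longrightarrow> A \<subseteq> carrier G \<Longrightarrow> m A = 0"
  shows False
proof -
  interpret group G by (rule assms)
  let ?X = "carrier G"
  obtain C where C: "0 \<le> C"
    "\<And>g h. g \<in> ?X \<Longrightarrow> h \<in> ?X \<Longrightarrow> norm (q (g \<otimes> h) - q g - \<pi> g (q h)) \<le> C"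
    using q unfolding QH1_as_def quasi_cocycle_def by blast
  have anti: "antisymmetric G \<pi> q" and unb: "\<not> bounded (q ` ?X)" using q by (auto simp: QH1_as_def)
  have conj: "norm (q (g \<otimes> x \<otimes> inv g) - \<pi> g (q x) - (q g - \<pi> (g \<otimes> x \<otimes> inv g) (q g))) \<le> 2 * C"
    if "g \<in> ?X" "x \<in> ?X" for g x
    by (rule quasi_cocycle_conj[OF is_group rep _ anti that]) (rule C(2))
  have "norm (q (g \<otimes> x \<otimes> inv g) - \<pi> g (q x)) \<le> 2 * norm (q g) + 2 * C"
    if g: "g \<in> ?X" and x: "x \<in> ?X" for g x
  proof -
    let ?y = "g \<otimes> x \<otimes> inv g"
    have "norm (\<pi> ?y (q g)) = norm (q g)" using orthogonal_rep_norm[OF rep] g x by simp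
    then have "norm (q g - \<pi> ?y (q g)) \<le> 2 * norm (q g)"
      using norm_triangle_ineq4[of "q g" "\<pi> ?y (q g)"] by simp
    then show ?thesis
      using conj[OF g x] norm_triangle_sub[of "q ?y - \<pi> g (q x)" "q g - \<pi> ?y (q g)"] by linarith
  qed
  from mean_expansion[OF is_group na rep weak this m]
  obtain r where r: "3 * m {x \<in> ?X. r < norm (q x)} \<le> 1" by auto
  define B where "B = {x \<in> ?X. norm (q x) \<le> r}"
  have BX: "B \<subseteq> ?X" by (auto simp: B_def)
  have "m (B \<union> {x \<in> ?X. r < norm (q x)}) = m B + m {x \<in> ?X. r < norm (q x)}"
    using m(1) unfolding fin_additive_prob_def
    by (intro additiveD[of "Pow ?X"]) (auto simp: B_def)
  moreover have "B \<union> {x \<in> ?X. r < norm (q x)} = ?X" by (auto simp: B_def)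
  moreover have "m ?X = 1" using m(1) by (simp add: fin_additive_prob_def)
  ultimately have mB: "m B > 1 / 2" using r by simp
  have "norm (q g) \<le> 2 * \<bar>r\<bar> + 2 * C + 1" if g: "g \<in> ?X" for g
  proof -
    let ?D = "B \<inter> (\<lambda>x. g \<otimes> x \<otimes> inv g) ` B"
    have gB: "(\<lambda>x. g \<otimes> x \<otimes> inv g) ` B \<subseteq> ?X" using g BX by auto
    have "infinite ?D"
    proof
      assume "finite ?D"
      then have D0: "m ?D = 0" using diffuse[of ?D] BX by blast
      \<comment> \<open>A finite overlap would be null, leaving two disjoint sets each of measure
        above 1/2.\<close>
      have "m (B - ?D \<union> (\<lambda>x. g \<otimes> x \<otimes> inv g) ` B) = m (B - ?D) + m ((\<lambda>x. g \<otimes> x \<otimes> inv g) ` B)"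
        using m(1) BX gB unfolding fin_additive_prob_def
        by (intro additiveD[of "Pow ?X"]) blast+
      moreover have "m ((B - ?D) \<union> ?D) = m (B - ?D) + m ?D"
        using m(1) BX unfolding fin_additive_prob_def
        by (intro additiveD[of "Pow ?X"]) blast+
      moreover have "(B - ?D) \<union> ?D = B" by blast
      moreover have "m (B - ?D \<union> (\<lambda>x. g \<otimes> x \<otimes> inv g) ` B) \<le> m ?X"
        by (rule fin_additive_prob_mono[OF m(1)]) (use BX gB in auto)
      ultimately show False using D0 mB m(2)[OF g BX] \<open>m ?X = 1\<close> by simp
    qed
    \<comment> \<open>Mixing excludes only finitely many \<open>y\<close>, so the infinite overlap
      contains one for which \<open>\<pi> y (q g)\<close> is nearly orthogonal to
      \<open>q g\<close>.\<close>
    have "eventually (\<lambda>y. \<bar>inner (\<pi> y (q g)) (q g)\<bar> < 1) (inf cofinite (principal ?X))"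
      using mix[unfolded mixing_def, rule_format, of "q g" "q g"]
      by (auto simp: tendsto_iff dest: spec[of _ 1])
    then have "finite {y. \<not> (y \<in> ?X \<longrightarrow> \<bar>inner (\<pi> y (q g)) (q g)\<bar> < 1)}"
      by (simp add: eventually_inf_principal eventually_cofinite)
    then obtain y where "y \<in> ?D" "y \<notin> {y. \<not> (y \<in> ?X \<longrightarrow> \<bar>inner (\<pi> y (q g)) (q g)\<bar> < 1)}"
      using \<open>infinite ?D\<close> by (meson finite_subset subsetI)
    then obtain x where x: "x \<in> B" "g \<otimes> x \<otimes> inv g \<in> B"
      and small: "\<bar>inner (\<pi> (g \<otimes> x \<otimes> inv g) (q g)) (q g)\<bar> < 1"
      using BX by blast
    let ?y = "g \<otimes> x \<otimes> inv g"
    have xX: "x \<in> ?X" and yX: "?y \<in> ?X" using x BX by auto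
    have "norm (\<pi> g (q x)) \<le> r" "norm (q ?y) \<le> r"
      using x orthogonal_rep_norm[OF rep g] by (auto simp: B_def)
    then have d: "norm (q g - \<pi> ?y (q g)) \<le> 2 * r + 2 * C"
      using conj[OF g xX] norm_triangle_sub[of "q g - \<pi> ?y (q g)" "q ?y - \<pi> g (q x)"]
        norm_triangle_ineq4[of "q ?y" "\<pi> g (q x)"]
        norm_minus_commute[of "q g - \<pi> ?y (q g)" "q ?y - \<pi> g (q x)"] by linarith
    have "2 * (norm (q g))\<^sup>2 - 2 * inner (\<pi> ?y (q g)) (q g) = (norm (q g - \<pi> ?y (q g)))\<^sup>2"
      using orthogonal_rep_inner[OF rep yX, of "q g" "q g"]
      by (simp add: power2_norm_eq_inner inner_diff_left inner_diff_right inner_commute)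
    also have "\<dots> \<le> (2 * r + 2 * C)\<^sup>2" using d by (intro power_mono) auto
    finally have "(norm (q g))\<^sup>2 \<le> (2 * r + 2 * C)\<^sup>2 + 1" using small zero_le_power2[of "2 * r + 2 * C"] by linarith
    also have "\<dots> \<le> (2 * \<bar>r\<bar> + 2 * C)\<^sup>2 + 1"
      using order_trans[OF norm_ge_zero d] by (intro add_right_mono power_mono) auto
    also have "\<dots> \<le> (2 * \<bar>r\<bar> + 2 * C + 1)\<^sup>2"
      unfolding power2_sum[of "2 * \<bar>r\<bar> + 2 * C" 1] using C(1) by simp
    finally show ?thesis by (rule power2_le_imp_le) (use C in auto)
  qed
  then have "bounded (q ` ?X)" unfolding bounded_iff by blast
  then show False using unb by simp
qed

section \<open>The FC-center\<close>

abbreviation conj_class :: "('g, 'm) monoid_scheme \<Rightarrow> 'g \<Rightarrow> 'g set" where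
  "conj_class G x \<equiv> (\<lambda>g. g \<otimes>\<^bsub>G\<^esub> x \<otimes>\<^bsub>G\<^esub> inv\<^bsub>G\<^esub> g) ` carrier G"

definition fc_center :: "('g, 'm) monoid_scheme \<Rightarrow> 'g set" where
  "fc_center G = {x \<in> carrier G. finite (conj_class G x)}"

context group
begin

lemma conj_conj:
  "g \<in> carrier G \<Longrightarrow> h \<in> carrier G \<Longrightarrow> x \<in> carrier G \<Longrightarrow>
    g \<otimes> (h \<otimes> x \<otimes> inv h) \<otimes> inv g = (g \<otimes> h) \<otimes> x \<otimes> inv (g \<otimes> h)"
  by (simp add: m_assoc inv_mult_group)

lemma conj_class_conj:
  assumes "g \<in> carrier G" "x \<in> carrier G"
  shows "conj_class G (g \<otimes> x \<otimes> inv g) = conj_class G x"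
proof (intro equalityI subsetI)
  fix y assume "y \<in> conj_class G (g \<otimes> x \<otimes> inv g)"
  then obtain h where "h \<in> carrier G" "y = h \<otimes> (g \<otimes> x \<otimes> inv g) \<otimes> inv h" by blast
  then show "y \<in> conj_class G x"
    using assms conj_conj by (intro image_eqI[of _ _ "h \<otimes> g"]) auto
next
  fix y assume "y \<in> conj_class G x"
  then obtain h where h: "h \<in> carrier G" "y = h \<otimes> x \<otimes> inv h" by blast
  have "(h \<otimes> inv g) \<otimes> (g \<otimes> x \<otimes> inv g) \<otimes> inv (h \<otimes> inv g) = y"
    using conj_conj[of "h \<otimes> inv g" g x] h assms by (simp add: m_assoc)
  then show "y \<in> conj_class G (g \<otimes> x \<otimes> inv g)"
    using assms h by (intro image_eqI[of _ _ "h \<otimes> inv g"]) auto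
qed

lemma conj_class_self: "x \<in> carrier G \<Longrightarrow> x \<in> conj_class G x"
  by (rule image_eqI[of _ _ \<one>]) auto

lemma conj_class_subset: "x \<in> carrier G \<Longrightarrow> conj_class G x \<subseteq> carrier G"
  by auto

lemma conj_class_image:
  assumes "g \<in> carrier G" "x \<in> carrier G"
  shows "(\<lambda>y. g \<otimes> y \<otimes> inv g) ` conj_class G x = conj_class G x"
proof (intro equalityI subsetI)
  fix y assume "y \<in> (\<lambda>y. g \<otimes> y \<otimes> inv g) ` conj_class G x"
  then obtain h where "h \<in> carrier G" "y = g \<otimes> (h \<otimes> x \<otimes> inv h) \<otimes> inv g" by blast
  then show "y \<in> conj_class G x"
    using assms conj_conj by (intro image_eqI[of _ _ "g \<otimes> h"]) auto
next
  fix y assume "y \<in> conj_class G x"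
  then obtain h where h: "h \<in> carrier G" "y = h \<otimes> x \<otimes> inv h" by blast
  have "y = g \<otimes> ((inv g \<otimes> h) \<otimes> x \<otimes> inv (inv g \<otimes> h)) \<otimes> inv g"
    using h assms by (subst conj_conj) (auto simp: m_assoc[symmetric])
  then show "y \<in> (\<lambda>y. g \<otimes> y \<otimes> inv g) ` conj_class G x"
  proof (rule image_eqI)
    show "(inv g \<otimes> h) \<otimes> x \<otimes> inv (inv g \<otimes> h) \<in> conj_class G x"
      using h assms by (intro imageI) auto
  qed
qed

lemma inj_on_conj: "g \<in> carrier G \<Longrightarrow> inj_on (\<lambda>x. g \<otimes> x \<otimes> inv g) (carrier G)"
  by (rule inj_onI) (simp add: m_assoc)

text \<open>The class of a product lies in the product of the classes, inversion carries classes to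
  classes, and conjugate elements share a class.\<close>

lemma fc_center_normal: "fc_center G \<lhd> G"
proof (rule normal_invI)
  show "subgroup (fc_center G) G"
  proof (rule subgroupI)
    show "fc_center G \<subseteq> carrier G" by (auto simp: fc_center_def)
    have "conj_class G \<one> = {\<one>}" using one_closed by (auto simp: image_iff)
    then show "fc_center G \<noteq> {}" by (auto simp: fc_center_def)
    fix x assume x: "x \<in> fc_center G"
    then have xc: "x \<in> carrier G" "finite (conj_class G x)" by (auto simp: fc_center_def)
    have "conj_class G (inv x) = m_inv G ` conj_class G x"
      unfolding image_image using xc by (intro image_cong) (auto simp: inv_mult_group m_assoc)
    then show "inv x \<in> fc_center G" using xc by (simp add: fc_center_def)
    fix y assume y: "y \<in> fc_center G"
    then have yc: "y \<in> carrier G" "finite (conj_class G y)" by (auto simp: fc_center_def)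
    have "g \<otimes> (x \<otimes> y) \<otimes> inv g = (g \<otimes> x \<otimes> inv g) \<otimes> (g \<otimes> y \<otimes> inv g)" if g: "g \<in> carrier G" for g
    proof -
      have "(g \<otimes> x \<otimes> inv g) \<otimes> (g \<otimes> y \<otimes> inv g) = g \<otimes> x \<otimes> (inv g \<otimes> g) \<otimes> y \<otimes> inv g"
        using g xc(1) yc(1) by (simp only: m_assoc m_closed inv_closed)
      then show ?thesis using g xc(1) yc(1) by (simp add: m_assoc)
    qed
    then have "conj_class G (x \<otimes> y) \<subseteq> (\<lambda>(a, b). a \<otimes> b) ` (conj_class G x \<times> conj_class G y)"
      by (intro image_subsetI) (simp add: image_iff Bex_def, blast)
    then have "finite (conj_class G (x \<otimes> y))"
      by (rule finite_subset) (use xc yc in blast)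
    then show "x \<otimes> y \<in> fc_center G" using xc yc by (simp add: fc_center_def)
  qed
  fix x h assume "x \<in> carrier G" "h \<in> fc_center G"
  then show "x \<otimes> h \<otimes> inv x \<in> fc_center G"
    using conj_class_conj[of x h] by (simp add: fc_center_def)
qed

text \<open>The uniform measure on a finite conjugacy class is exactly invariant, hence so is any
  limit. Letting the class leave every finite set makes the limit diffuse.\<close>

lemma infinite_fc_center_mean:
  assumes inf: "infinite (fc_center G)"
  obtains m where "fin_additive_prob (carrier G) m"
    "\<And>g A. g \<in> carrier G \<Longrightarrow> A \<subseteq> carrier G \<Longrightarrow> m ((\<lambda>x. g \<otimes> x \<otimes> inv g) ` A) = m A"
    "\<And>A. finite A \<Longrightarrow> A \<subseteq> carrier G \<Longrightarrow> m A = 0"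
proof -
  define M where "M x A = real (card (A \<inter> conj_class G x)) / real (card (conj_class G x))" for x A
  \<comment> \<open>Elements of the FC-center tending to infinity; the filter is proper because the
    FC-center is infinite.\<close>
  define F where "F = inf cofinite (principal (fc_center G))"
  have Fbot: "F \<noteq> bot"
  proof
    assume "F = bot"
    then have "eventually (\<lambda>_. False) F" by simp
    then have "finite (fc_center G)" by (simp add: F_def eventually_inf_principal eventually_cofinite)
    then show False using inf by simp
  qed
  have "M x A \<in> {0..1}" for x A
  proof (cases "finite (conj_class G x)")
    case True
    then have "card (A \<inter> conj_class G x) \<le> card (conj_class G x)" by (intro card_mono) auto
    then show ?thesis by (auto simp: M_def divide_le_eq)
  qed (simp add: M_def)
  then obtain m F' where F': "F' \<le> F" "F' \<noteq> bot" and m: "\<And>A. ((\<lambda>i. M i A) \<longlongrightarrow> m A) F'"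
    using cluster_mean[OF Fbot] by metis
  have evF: "eventually P F'" if "eventually P F" for P using filter_leD[OF F'(1) that] .
  have evc: "eventually (\<lambda>x. x \<in> carrier G \<and> finite (conj_class G x)) F'"
    by (rule evF) (simp add: F_def eventually_inf_principal fc_center_def)
  have lim: "m A = c" if "eventually (\<lambda>x. M x A = c) F'" for A c
    using tendsto_unique[OF F'(2) m tendsto_eventually[OF that]] .
  show thesis
  proof (rule that)
    show "fin_additive_prob (carrier G) m"
      unfolding fin_additive_prob_def additive_def
    proof (intro conjI allI ballI impI)
      show "0 \<le> m A" for A
        by (rule tendsto_lowerbound[OF m _ F'(2)]) (simp add: M_def)
      show "m (carrier G) = 1"
      proof (rule lim, rule eventually_mono[OF evc])
        fix x assume x: "x \<in> carrier G \<and> finite (conj_class G x)"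
        then have "carrier G \<inter> conj_class G x = conj_class G x" using conj_class_subset by blast
        moreover have "card (conj_class G x) \<noteq> 0" using x conj_class_self[of x] by (metis card_0_eq empty_iff)
        ultimately show "M x (carrier G) = 1" by (simp add: M_def)
      qed
    next
      fix A B :: "'a set" assume AB: "A \<inter> B = {}"
      have "eventually (\<lambda>x. M x A + M x B = M x (A \<union> B)) F'"
      proof (rule eventually_mono[OF evc])
        fix x assume x: "x \<in> carrier G \<and> finite (conj_class G x)"
        have "card ((A \<union> B) \<inter> conj_class G x) = card (A \<inter> conj_class G x) + card (B \<inter> conj_class G x)"
          unfolding Int_Un_distrib2 by (rule card_Un_disjoint) (use x AB in auto)
        then show "M x A + M x B = M x (A \<union> B)" by (simp add: M_def add_divide_distrib)
      qed
      then have "((\<lambda>x. M x (A \<union> B)) \<longlongrightarrow> m A + m B) F'"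
        using tendsto_add[OF m m] by (rule Lim_transform_eventually[rotated])
      then show "m (A \<union> B) = m A + m B" using tendsto_unique[OF F'(2) m] by blast
    qed
    show "m ((\<lambda>x. g \<otimes> x \<otimes> inv g) ` A) = m A" if g: "g \<in> carrier G" and A: "A \<subseteq> carrier G" for g A
    proof -
      let ?c = "\<lambda>x. g \<otimes> x \<otimes> inv g"
      have "eventually (\<lambda>x. M x A = M x (?c ` A)) F'"
      proof (rule eventually_mono[OF evc])
        fix x assume x: "x \<in> carrier G \<and> finite (conj_class G x)"
        have "?c ` A \<inter> conj_class G x = ?c ` A \<inter> ?c ` conj_class G x"
          using conj_class_image[OF g] x by simp
        also have "\<dots> = ?c ` (A \<inter> conj_class G x)"
          by (rule inj_on_image_Int[OF inj_on_conj[OF g] A, symmetric]) (use x conj_class_subset in blast)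
        finally have "card (?c ` A \<inter> conj_class G x) = card (A \<inter> conj_class G x)"
          using inj_on_subset[OF inj_on_conj[OF g], of "A \<inter> conj_class G x"] A by (simp add: card_image le_infI1)
        then show "M x A = M x (?c ` A)" by (simp add: M_def)
      qed
      then have "((\<lambda>x. M x (?c ` A)) \<longlongrightarrow> m A) F'"
        using m by (rule Lim_transform_eventually[rotated])
      then show ?thesis using tendsto_unique[OF F'(2) m] by blast
    qed
    show "m A = 0" if A: "finite A" "A \<subseteq> carrier G" for A
    proof (rule lim, rule evF)
      \<comment> \<open>A finite set meets only finitely many finite classes, so it is charged by
        only finitely many of the uniform measures.\<close>
      have "{x \<in> fc_center G. M x A \<noteq> 0} \<subseteq> (\<Union>a\<in>A \<inter> fc_center G. conj_class G a)"
      proof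
        fix x assume "x \<in> {x \<in> fc_center G. M x A \<noteq> 0}"
        then have x: "x \<in> carrier G" "finite (conj_class G x)" and "A \<inter> conj_class G x \<noteq> {}"
          by (auto simp: fc_center_def M_def)
        then obtain g where g: "g \<in> carrier G" "g \<otimes> x \<otimes> inv g \<in> A" by blast
        then have "conj_class G (g \<otimes> x \<otimes> inv g) = conj_class G x" using conj_class_conj x by blast
        then have "g \<otimes> x \<otimes> inv g \<in> A \<inter> fc_center G" "x \<in> conj_class G (g \<otimes> x \<otimes> inv g)"
          using x g A conj_class_self[of x] by (auto simp: fc_center_def)
        then show "x \<in> (\<Union>a\<in>A \<inter> fc_center G. conj_class G a)" by blast
      qed
      moreover have "finite (\<Union>a\<in>A \<inter> fc_center G. conj_class G a)"
        using A by (auto simp: fc_center_def)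
      ultimately have "finite {x \<in> fc_center G. M x A \<noteq> 0}" by (rule finite_subset)
      then show "eventually (\<lambda>x. M x A = 0) F"
        by (simp add: F_def eventually_inf_principal eventually_cofinite)
    qed
  qed
qed

end

section \<open>The quotient by the FC-center\<close>

text \<open>The quotient group is realized on coset representatives to keep the element type of \<open>G\<close>.\<close>

lemma transversal_exact_sequence:
  fixes G :: "'g monoid" (structure)
  assumes "group G" and N: "N \<lhd> G"
  obtains G0 :: "'g monoid" and p where
    "short_exact_sequence G0 G (G\<lparr>carrier := N\<rparr>) p id" "p ` carrier G = carrier G0"
    "p \<in> hom G G0" "\<And>x y. x \<in> carrier G \<Longrightarrow> y \<in> carrier G \<Longrightarrow> p x = p y \<longleftrightarrow> x \<otimes> inv y \<in> N"
proof -
  interpret group G by (rule assms)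
  interpret N: normal N G by (rule N)
  \<comment> \<open>The choice depends on the coset alone, so elements of one coset get the same
    representative.\<close>
  define p where "p x = (SOME y. y \<in> N #> x)" for x
  have p_mem: "p x \<in> N #> x" if "x \<in> carrier G" for x
  proof -
    have "x \<in> N #> x" using rcos_self[OF that N.subgroup_axioms] .
    then show ?thesis unfolding p_def by (rule someI)
  qed
  have p_carr: "p x \<in> carrier G" if "x \<in> carrier G" for x
    using p_mem[OF that] r_coset_subset_G[OF N.subset that] by blast
  have p_coset: "N #> p x = N #> x" if "x \<in> carrier G" for x
    using repr_independence[OF p_mem[OF that] that N.subgroup_axioms] by simp
  have p_eq: "p x = p y \<longleftrightarrow> N #> x = N #> y" if "x \<in> carrier G" "y \<in> carrier G" for x y
  proof
    show "N #> x = N #> y" if "p x = p y"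
      using p_coset[OF \<open>x \<in> carrier G\<close>] p_coset[OF \<open>y \<in> carrier G\<close>] that by simp
  qed (simp add: p_def)
  have coset_eq: "N #> x = N #> y \<longleftrightarrow> x \<otimes> inv y \<in> N" if "x \<in> carrier G" "y \<in> carrier G" for x y
  proof -
    have "N #> x = N #> y \<longleftrightarrow> x \<in> N #> y"
      using rcos_self[OF that(1) N.subgroup_axioms] repr_independence[OF _ that(2) N.subgroup_axioms] by blast
    then show ?thesis using N.rcos_module[OF is_group that(2,1)] by simp
  qed
  define G0 :: "'g monoid" where
    "G0 = \<lparr>carrier = p ` carrier G, mult = (\<lambda>a b. p (a \<otimes> b)), one = p \<one>\<rparr>"
  have G0: "carrier G0 = p ` carrier G" "a \<otimes>\<^bsub>G0\<^esub> b = p (a \<otimes> b)" "\<one>\<^bsub>G0\<^esub> = p \<one>" for a b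
    by (simp_all add: G0_def)
  \<comment> \<open>Normality enters through the product of cosets and makes \<open>p\<close>
    multiplicative.\<close>
  have pp: "p (p x \<otimes> p y) = p (x \<otimes> y)" if "x \<in> carrier G" "y \<in> carrier G" for x y
  proof -
    have "N #> (p x \<otimes> p y) = N #> (x \<otimes> y)"
      using that p_carr p_coset by (simp only: N.rcos_sum[symmetric])
    then show ?thesis using that p_carr p_eq by simp
  qed
  have grp: "group G0"
  proof (rule groupI)
    fix x assume "x \<in> carrier G0"
    then obtain a where a: "a \<in> carrier G" "x = p a" by (auto simp: G0)
    have "p (inv a) \<otimes>\<^bsub>G0\<^esub> x = \<one>\<^bsub>G0\<^esub>" using a pp[of "inv a" a] by (simp add: G0)
    then show "\<exists>y\<in>carrier G0. y \<otimes>\<^bsub>G0\<^esub> x = \<one>\<^bsub>G0\<^esub>" using a by (auto simp: G0(1))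
    show "\<one>\<^bsub>G0\<^esub> \<otimes>\<^bsub>G0\<^esub> x = x" using a pp[of \<one> a] by (simp add: G0)
    fix y assume "y \<in> carrier G0"
    then obtain b where b: "b \<in> carrier G" "y = p b" by (auto simp: G0)
    show "x \<otimes>\<^bsub>G0\<^esub> y \<in> carrier G0" using a b pp by (simp add: G0)
    fix z assume "z \<in> carrier G0"
    then obtain c where c: "c \<in> carrier G" "z = p c" by (auto simp: G0)
    show "x \<otimes>\<^bsub>G0\<^esub> y \<otimes>\<^bsub>G0\<^esub> z = x \<otimes>\<^bsub>G0\<^esub> (y \<otimes>\<^bsub>G0\<^esub> z)"
      using a b c by (simp add: G0 pp m_assoc)
  qed (auto simp: G0)
  have hom: "p \<in> hom G G0" by (rule homI) (auto simp: G0 pp)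
  have kernel: "kernel G G0 p = N"
    using p_eq coset_eq N.subset by (auto simp: kernel_def G0)
  have inc: "id \<in> hom (G\<lparr>carrier := N\<rparr>) G" using N.subset by (auto simp: hom_def)
  have grpN: "group (G\<lparr>carrier := N\<rparr>)" by (rule N.subgroup_is_group[OF is_group])
  have "short_exact_sequence G0 G (G\<lparr>carrier := N\<rparr>) p id"
    unfolding short_exact_sequence_iff
    using grp grpN hom inc kernel
    by (auto simp: epi_def mon_def G0 group_hom_def group_hom_axioms_def)
  then show thesis
    by (rule that) (use hom p_eq coset_eq in \<open>auto simp: G0\<close>)
qed

text \<open>The fibres of \<open>p\<close> are cosets of a finite group, so infinite sets have
  infinite images. A non-trivial element of the quotient lifts to an element outside the FC-center,
  whose infinite class maps onto the class below.\<close>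

lemma icc_quotient_by_fc_center:
  fixes G :: "'g monoid" (structure)
  assumes "group G" and inf: "infinite (carrier G)" and fin: "finite (fc_center G)"
  shows "\<exists>(F :: 'g monoid) (G0 :: 'g monoid) i p.
    short_exact_sequence G0 G F p i \<and> finite (carrier F) \<and> icc G0"
proof -
  interpret group G by (rule assms)
  obtain G0 :: "'g monoid" and p where
    ses: "short_exact_sequence G0 G (G\<lparr>carrier := fc_center G\<rparr>) p id"
    and p: "p ` carrier G = carrier G0" "p \<in> hom G G0"
    and p_eq: "\<And>x y. x \<in> carrier G \<Longrightarrow> y \<in> carrier G \<Longrightarrow> p x = p y \<longleftrightarrow> x \<otimes> inv y \<in> fc_center G"
    using transversal_exact_sequence[OF is_group fc_center_normal] by metis
  have "group G0" using ses by (auto simp: short_exact_sequence_iff group_hom_def)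
  then interpret p: group_hom G G0 p using p(2) by (simp add: group_hom_def group_hom_axioms_def)
  have finite_preimage: "finite A" if A: "A \<subseteq> carrier G" and pA: "finite (p ` A)" for A
  proof (rule finite_subset)
    let ?r = "\<lambda>b. SOME y. y \<in> A \<and> p y = b"
    \<comment> \<open>Each point of \<open>A\<close> differs by an element of the FC-center from the
      point chosen in its fibre.\<close>
    show "A \<subseteq> (\<lambda>(n, b). n \<otimes> ?r b) ` (fc_center G \<times> p ` A)"
    proof
      fix x assume x: "x \<in> A"
      define y where "y = ?r (p x)"
      have "y \<in> A \<and> p y = p x" unfolding y_def by (rule someI[of _ x]) (use x in simp)
      then have y: "y \<in> carrier G" "p x = p y" and xG: "x \<in> carrier G" using A x by auto
      show "x \<in> (\<lambda>(n, b). n \<otimes> ?r b) ` (fc_center G \<times> p ` A)"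
      proof (rule image_eqI)
        show "x = (case (x \<otimes> inv y, p x) of (n, b) \<Rightarrow> n \<otimes> ?r b)"
          unfolding prod.case y_def[symmetric] using xG y(1) by (simp add: m_assoc)
        show "(x \<otimes> inv y, p x) \<in> fc_center G \<times> p ` A"
          using p_eq[OF xG y(1)] y(2) imageI[OF x, of p] by simp
      qed
    qed
  qed (use fin pA in auto)
  have "icc G0"
    unfolding icc_def
  proof (intro conjI ballI)
    show "infinite (carrier G0)" using finite_preimage[of "carrier G"] inf p(1) by auto
    fix x assume "x \<in> carrier G0 - {\<one>\<^bsub>G0\<^esub>}"
    then have "x \<in> p ` carrier G" "x \<noteq> \<one>\<^bsub>G0\<^esub>" using p(1) by auto
    then obtain a where a: "a \<in> carrier G" "x = p a" "p a \<noteq> \<one>\<^bsub>G0\<^esub>" by blast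
    have "a \<notin> fc_center G" using p_eq[OF a(1) one_closed] a by auto
    then have "infinite (conj_class G a)" using a by (simp add: fc_center_def)
    then have "infinite (p ` conj_class G a)" using finite_preimage[OF conj_class_subset[OF a(1)]] by blast
    moreover have "p ` conj_class G a = (\<lambda>g. g \<otimes>\<^bsub>G0\<^esub> x \<otimes>\<^bsub>G0\<^esub> inv\<^bsub>G0\<^esub> g) ` p ` carrier G"
      unfolding image_image using a by (intro image_cong) auto
    ultimately show "infinite (conj_class G0 x)" unfolding p(1) by simp
  qed
  moreover have "finite (carrier (G\<lparr>carrier := fc_center G\<rparr>))" using fin by simp
  ultimately show ?thesis using ses by blast
qed

section \<open>Torsion-free groups and inner amenable icc groups\<close>

text \<open>A finite FC-center consists of torsion elements, since two powers of any element
  coincide by the pigeonhole principle; torsion-freeness makes it trivial.\<close>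

lemma torsion_free_imp_icc:
  fixes G (structure)
  assumes "group G" and inf: "infinite (carrier G)" and fin: "finite (fc_center G)"
    and tf: "torsion_free G"
  shows "icc G"
proof -
  interpret group G by (rule assms)
  interpret FC: normal "fc_center G" G by (rule fc_center_normal)
  have "x = \<one>" if x: "x \<in> fc_center G" for x
  proof (rule ccontr)
    assume "x \<noteq> \<one>"
    have xG: "x \<in> carrier G" using x unfolding fc_center_def by blast
    have pow: "x [^] n \<in> fc_center G" for n :: nat
      by (induction n) (use x FC.m_closed FC.one_closed in auto)
    have "finite (range (\<lambda>n::nat. x [^] n))" by (rule finite_subset[OF _ fin]) (use pow in blast)
    then have "\<not> inj (\<lambda>n::nat. x [^] n)" using finite_imageD infinite_UNIV_nat by blast
    then obtain i j :: nat where "i < j" "x [^] i = x [^] j"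
      by (metis inj_onI linorder_neqE_nat)
    moreover have "x [^] i \<otimes> x [^] (j - i) = x [^] j"
      using nat_pow_mult[OF xG, of i "j - i"] \<open>i < j\<close> by simp
    ultimately have "x [^] i \<otimes> x [^] (j - i) = x [^] i" by simp
    then have "x [^] (j - i) = \<one>" using xG by (simp only: l_cancel_one nat_pow_closed)
    moreover have "0 < j - i" using \<open>i < j\<close> by simp
    ultimately show False using tf xG \<open>x \<noteq> \<one>\<close> unfolding torsion_free_def by blast
  qed
  then have "infinite (conj_class G x)" if "x \<in> carrier G - {\<one>}" for x
    using that unfolding fc_center_def by blast
  then show ?thesis using inf unfolding icc_def by blast
qed

text \<open>A point of positive mass would have infinitely many conjugates of the same mass,
  exceeding total mass 1. So the mean has no atoms off the unit and vanishes on finite sets.\<close>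

lemma icc_inner_amenable_mean:
  fixes G (structure)
  assumes "group G" and icc: "icc G" and ia: "inner_amenable G"
  obtains m where "fin_additive_prob (carrier G) m"
    "\<And>g A. g \<in> carrier G \<Longrightarrow> A \<subseteq> carrier G \<Longrightarrow> m ((\<lambda>x. g \<otimes> x \<otimes> inv g) ` A) = m A"
    "\<And>A. finite A \<Longrightarrow> A \<subseteq> carrier G \<Longrightarrow> m A = 0"
proof -
  interpret group G by (rule assms)
  let ?X = "carrier G" and ?Y = "carrier G - {\<one>}"
  obtain m where m: "fin_additive_prob ?Y m"
    and inv: "\<And>g A. g \<in> ?X \<Longrightarrow> A \<subseteq> ?Y \<Longrightarrow> m ((\<lambda>x. g \<otimes> x \<otimes> inv g) ` A) = m A"
    using ia unfolding inner_amenable_def by blast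
  have add: "m (A \<union> B) = m A + m B" if "A \<subseteq> ?Y" "B \<subseteq> ?Y" "A \<inter> B = {}" for A B
    using m that unfolding fin_additive_prob_def by (intro additiveD[of "Pow ?Y"]) auto
  have conj_one: "g \<otimes> x \<otimes> inv g = \<one> \<longleftrightarrow> x = \<one>" if "g \<in> ?X" "x \<in> ?X" for g x
    using inj_onD[OF inj_on_conj[OF that(1)], of x \<one>] that by auto
  have point: "m {x} = 0" if x: "x \<in> ?Y" for x
  proof (rule ccontr)
    assume nz: "m {x} \<noteq> 0"
    have "0 \<le> m {x}" using m x by (simp add: fin_additive_prob_def)
    then have pos: "0 < m {x}" using nz by simp
    obtain n :: nat where n: "1 < real n * m {x}" using reals_Archimedean3[OF pos] by blast
    have "infinite (conj_class G x)" using icc x by (simp add: icc_def)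
    then obtain T where T: "T \<subseteq> conj_class G x" "finite T" "card T = n"
      using infinite_arbitrarily_large by blast
    have TY: "T \<subseteq> ?Y"
    proof
      fix t assume "t \<in> T"
      then obtain g where "g \<in> ?X" "t = g \<otimes> x \<otimes> inv g" using T(1) by blast
      then show "t \<in> ?Y" using conj_one[of g x] x by simp
    qed
    have pt: "m {t} = m {x}" if "t \<in> T" for t
    proof -
      obtain g where "g \<in> ?X" "t = g \<otimes> x \<otimes> inv g" using T(1) \<open>t \<in> T\<close> by blast
      then show ?thesis using inv[of g "{x}"] x by simp
    qed
    have "m T = m (\<Union>t\<in>T. {t})" by simp
    also have "\<dots> = (\<Sum>t\<in>T. m {t})"
      by (rule fin_additive_prob_UN[OF m T(2)]) (use TY in \<open>auto simp: disjoint_family_on_def\<close>)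
    also have "\<dots> = real n * m {x}" using pt T(3) by simp
    finally have "1 < m T" using n by simp
    moreover have "m T \<le> m ?Y" by (rule fin_additive_prob_mono[OF m TY]) simp
    ultimately show False using m by (simp add: fin_additive_prob_def)
  qed
  \<comment> \<open>Extension to the whole group with mass 0 at the unit, which conjugation
    fixes.\<close>
  define m' where "m' A = m (A - {\<one>})" for A
  show thesis
  proof (rule that[of m'])
    show "fin_additive_prob ?X m'"
      unfolding fin_additive_prob_def additive_def
    proof (intro conjI allI ballI impI)
      show "0 \<le> m' A" if "A \<subseteq> ?X" for A
      proof -
        have "A - {\<one>} \<subseteq> ?Y" using that by blast
        then show ?thesis using m by (simp add: m'_def fin_additive_prob_def)
      qed
      show "m' ?X = 1" using m by (simp add: m'_def fin_additive_prob_def)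
      fix A B assume "A \<in> Pow ?X" "B \<in> Pow ?X" "A \<inter> B = {}"
      then show "m' (A \<union> B) = m' A + m' B"
        using add[of "A - {\<one>}" "B - {\<one>}"] by (simp add: m'_def Un_Diff) blast
    qed
    show "m' ((\<lambda>x. g \<otimes> x \<otimes> inv g) ` A) = m' A" if g: "g \<in> ?X" and A: "A \<subseteq> ?X" for g A
    proof -
      have "(\<lambda>x. g \<otimes> x \<otimes> inv g) ` A - {\<one>} = (\<lambda>x. g \<otimes> x \<otimes> inv g) ` (A - {\<one>})"
        using conj_one[OF g] A by (auto simp: subset_iff)
      moreover have "A - {\<one>} \<subseteq> ?Y" using A by blast
      ultimately show ?thesis using inv[OF g] by (simp add: m'_def)
    qed
    show "m' A = 0" if "finite A" "A \<subseteq> ?X" for A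
    proof -
      have AY: "A - {\<one>} \<subseteq> ?Y" using that by blast
      have "m' A = m (\<Union>a\<in>A - {\<one>}. {a})" by (simp add: m'_def)
      also have "\<dots> = (\<Sum>a\<in>A - {\<one>}. m {a})"
        by (rule fin_additive_prob_UN[OF m]) (use that in \<open>auto simp: disjoint_family_on_def\<close>)
      also have "\<dots> = 0" using AY point by (intro sum.neutral) blast
      finally show ?thesis .
    qed
  qed
qed

theorem theorem2:
  fixes \<Gamma> :: "'g monoid"
  assumes "group \<Gamma>"
    and "countable (carrier \<Gamma>)"
    and "NC1 TYPE('h::{real_inner,complete_space}) \<Gamma>"
  shows "(\<exists>(F :: 'g monoid) (\<Gamma>\<^sub>0 :: 'g monoid) i p.
            short_exact_sequence \<Gamma>\<^sub>0 \<Gamma> F p i \<and> finite (carrier F) \<and> icc \<Gamma>\<^sub>0)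
       \<and> (torsion_free \<Gamma> \<longrightarrow> icc \<Gamma> \<and> \<not> inner_amenable \<Gamma>)"
proof -
  interpret group \<Gamma> by (rule assms)
  obtain \<pi> :: "'g \<Rightarrow> 'h \<Rightarrow> 'h" and q where na: "\<not> amenable \<Gamma>"
    and \<pi>: "orthogonal_rep \<Gamma> \<pi>" "weakly_ell2 \<Gamma> \<pi>" "mixing \<Gamma> \<pi>" and q: "q \<in> QH1_as \<Gamma> \<pi>"
    using assms(3) unfolding NC1_def by blast
  note no_mean = no_diffuse_conj_invariant_mean[OF assms(1) na \<pi> q]
  have "\<not> bounded (q ` carrier \<Gamma>)" using q by (simp add: QH1_as_def)
  then have inf: "infinite (carrier \<Gamma>)" using finite_imp_bounded by blast
  have fin: "finite (fc_center \<Gamma>)"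
  proof (rule ccontr)
    assume "infinite (fc_center \<Gamma>)"
    then show False by (rule infinite_fc_center_mean) (rule no_mean)
  qed
  have "\<not> inner_amenable \<Gamma>" if "icc \<Gamma>"
  proof
    assume "inner_amenable \<Gamma>"
    with assms(1) that show False by (rule icc_inner_amenable_mean) (rule no_mean)
  qed
  then show ?thesis
    using icc_quotient_by_fc_center[OF assms(1) inf fin] torsion_free_imp_icc[OF assms(1) inf fin]
    by blast
qed

end
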